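(* For real parameters $a,b$ let $$p(x) = \frac{ (2a - 4ab) + x^2 (2a+4ab-4a^2) } { (1 - x^2)^2 } + \frac{ (2b+4ab) + x^2 (-2b-4b^2 +4ab) } { (1 + x^2)^2 }.$$ (A) Suppose $a, b$ satisfy $$\frac{1}{2} \le a \le 1, \qquad \frac{1}{4}\left( -(5+4a) + (25+48a)^{1/2} \right) \le b \le a - \frac{1}{2} .$$ If $f$ is an analytic function in $\Delta$ satisfying $$| Sf(z) | \le 2 p( |z| ) , \qquad z \in \Delta ,$$ then $f$ is univalent in $\Delta$. (B) Suppose $a,b$ satisfy the more restrictive conditions $\frac{1}{2} \le a \le 1$ and $$\max \Big\{ a-1,\; \frac{1}{4}\left( -(5+4a) + (25+48a)^{1/2} \right) \Big\} \le b \le \min \Big\{ a - \frac{1}{2},\; - \frac{1}{2} + \frac{1}{2} \Big( 1 +4a(1-a) \Big)^{1/2} \Big\} .$$ Then $p(z)$ is self majorant, and $$f(z) = \int_0^z (1 - t^2)^{-2a} (1 + t^2)^{2b} \, dt$$ is an odd univalent function in $\Delta$. Moreover, the univalence criterion $|Sf(z)|\le 2p(|z|)$, $z\in\Delta$, is sharp.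
   Context: $\Delta=\{z\in\mathbb{C}: |z|<1\}$ is the open unit disc. For an analytic locally univalent function $f$, the Schwarzian derivative is $Sf = \left(\frac{f''}{f'}\right)' - \frac12\left(\frac{f''}{f'}\right)^2$; a hypothesis on $Sf$ in $\Delta$ presupposes that $f$ is locally univalent in $\Delta$. Univalent means injective. The formula for $p$ is also used for complex argument $z\in\Delta$. An analytic function $p$ on $\Delta$ is called self majorant in $\Delta$ if $|p(z)|\le p(|z|)$ for all $z\in\Delta$. The univalence criterion $|Sf(z)|\le 2p(|z|)$, $z\in\Delta$, is called sharp if, for analytic (locally univalent) $f$ in $\Delta$, the conditions $Sf(x)\ge 2p(x)$ for $-1<x<1$ (in particular $Sf(x)$ is real there) and $Sf(z)\not\equiv 2p(z)$ imply that $f$ is not univalent in $\Delta$. The powers $(1-t^2)^{-2a}$ and $(1+t^2)^{2b}$ denote the analytic branches in $\Delta$ equal to $1$ at $t=0$. *)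

theory Defs
  imports "HOL-Complex_Analysis.Complex_Analysis"
begin

abbreviation unit_disc :: "complex set" where
  "unit_disc \<equiv> ball 0 1"

definition univalent_on :: "(complex \<Rightarrow> complex) \<Rightarrow> complex set \<Rightarrow> bool" where
  "univalent_on f S \<longleftrightarrow> inj_on f S"

definition locally_univalent_on :: "(complex \<Rightarrow> complex) \<Rightarrow> complex set \<Rightarrow> bool" where
  "locally_univalent_on f S \<longleftrightarrow>
     (\<forall>z\<in>S. \<exists>U. open U \<and> z \<in> U \<and> U \<subseteq> S \<and> univalent_on f U)"

definition Schwarzian :: "(complex \<Rightarrow> complex) \<Rightarrow> complex \<Rightarrow> complex" where
  "Schwarzian f z =
     deriv (\<lambda>w. deriv (deriv f) w / deriv f w) z - 1/2 * (deriv (deriv f) z / deriv f z)\<^sup>2"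

(* Polymorphic, so that the same formula serves for real x and for complex z. *)
definition pfun :: "real \<Rightarrow> real \<Rightarrow> 'a::real_field \<Rightarrow> 'a" where
  "pfun a b x =
     (of_real (2*a - 4*a*b) + x\<^sup>2 * of_real (2*a + 4*a*b - 4*a\<^sup>2)) / (1 - x\<^sup>2)\<^sup>2
   + (of_real (2*b + 4*a*b) + x\<^sup>2 * of_real (- 2*b - 4*b\<^sup>2 + 4*a*b)) / (1 + x\<^sup>2)\<^sup>2"

definition self_majorant :: "(complex \<Rightarrow> complex) \<Rightarrow> bool" where
  "self_majorant p \<longleftrightarrow>
     p analytic_on unit_disc \<and>
     (\<forall>z\<in>unit_disc. p (of_real (cmod z)) \<in> \<real> \<and> cmod (p z) \<le> Re (p (of_real (cmod z))))"

(* Sharpness of the criterion |Sf(z)| <= 2 p(|z|).  It is meant for p real on (-1,1),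
   where Re (p x) is just the value p(x). *)
definition sharp_criterion :: "(complex \<Rightarrow> complex) \<Rightarrow> bool" where
  "sharp_criterion p \<longleftrightarrow>
     (\<forall>f. f analytic_on unit_disc \<longrightarrow> locally_univalent_on f unit_disc \<longrightarrow>
        (\<forall>x::real. -1 < x \<and> x < 1 \<longrightarrow>
            Schwarzian f (of_real x) \<in> \<real> \<and>
            Re (Schwarzian f (of_real x)) \<ge> 2 * Re (p (of_real x))) \<longrightarrow>
        \<not> (\<forall>z\<in>unit_disc. Schwarzian f z = 2 * p z) \<longrightarrow>
        \<not> univalent_on f unit_disc)"

(* The powers are principal: 1 - t^2 and 1 + t^2 have positive real part for |t| < 1, so
   these are the analytic branches in the disc equal to 1 at t = 0. *)
definition extremal :: "real \<Rightarrow> real \<Rightarrow> complex \<Rightarrow> complex" where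
  "extremal a b z = contour_integral (linepath 0 z)
     (\<lambda>t. (1 - t\<^sup>2) powr of_real (- 2*a) * (1 + t\<^sup>2) powr of_real (2*b))"

end

theory Submission
  imports Defs
begin

text \<open>
  Write \<open>y = (1 - x\<^sup>2)\<^sup>a (1 + x\<^sup>2)\<^sup>-\<^sup>b\<close>.  A computation of the logarithmic derivative gives
  \<open>y'' = - p y\<close>, and \<open>y\<close> is positive on \<open>(-1, 1)\<close>; everything rests on this one solution.

  On the other side, if \<open>f\<close> is locally univalent and \<open>\<phi> = (f')\<^sup>-\<^sup>1\<^sup>/\<^sup>2\<close>, then \<open>\<phi>\<close> and \<open>f \<phi>\<close> span
  the solutions of \<open>u'' = - (Sf / 2) u\<close> (\<open>Schwarzian_linearization\<close>).  A solution
  \<open>(c\<^sub>1 f + c\<^sub>2) \<phi>\<close> with \<open>c\<^sub>1 \<noteq> 0\<close> vanishes exactly where \<open>f\<close> takes one particular value.  So univalence of \<open>f\<close> is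
  a statement about how often solutions of a linear equation vanish, and Sturm comparison with
  \<open>y\<close> decides it in both directions.

  Criterion: this is Nehari's argument.  If \<open>f z1 = f z2\<close>, restrict the solution vanishing at \<open>z1\<close>
  and \<open>z2\<close> to the hyperbolic geodesic through these points.  Parametrised so that \<open>0\<close> goes to the point
  nearest the origin, the geodesic satisfies \<open>\<bar>T x\<bar> \<ge> \<bar>x\<bar>\<close>, and since \<open>(1 - x\<^sup>2)\<^sup>2 p x\<close>
  decreases in \<open>\<bar>x\<bar>\<close> (\<open>pfun_weighted_antimono\<close>), the transported equation on \<open>(-1, 1)\<close> has a
  coefficient bounded by \<open>p\<close>.  The positive solution \<open>y\<close> then forbids two zeros
  (\<open>Sturm_comparison_complex\<close>).  The two bounds on \<open>b\<close> in (A) make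
  the slope of the weighted function in \<open>x\<^sup>2\<close> nonpositive at the two ends \<open>x = 0\<close> and \<open>x = 1\<close>; that
  suffices because the slope, in a suitable variable, is a cubic that is increasing or has only nonpositive coefficients.

  Extremal function and self-majorance: the derivative of the extremal function is \<open>y\<^sup>-\<^sup>2\<close>, so its Schwarzian
  is \<open>2 p\<close>.  The restrictions in (B) make the power series of \<open>p\<close> have nonnegative coefficients
  (\<open>pfun_coefficients_nonneg\<close>), hence \<open>\<bar>p z\<bar> \<le> p \<bar>z\<bar>\<close>, and the criterion applies to the extremal function.

  Sharpness: because \<open>a \<ge> 1/2\<close>, the integral of \<open>y\<^sup>-\<^sup>2\<close> diverges at both ends.  If \<open>Q = Sf / 2 \<ge> p\<close>
  on the axis with strict inequality at \<open>x0\<close>, the real solution of \<open>u'' = - Q u\<close> with the initial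
  data of \<open>y\<close> at \<open>x0\<close> has \<open>(u / y)' \<le> - c y\<^sup>-\<^sup>2\<close> from some point to the right of \<open>x0\<close> on, so it must
  reach zero before \<open>1\<close>, and likewise on the left (\<open>Sturm_two_zeros\<close>).  Two zeros mean that \<open>f\<close> takes a
  value twice.
\<close>

section \<open>The Schwarzian derivative and its linear equation\<close>

text \<open>
  The disc is simply connected and \<open>f'\<close> has no zero, so \<open>f' = exp g\<close>; in terms of the logarithm \<open>g\<close> the
  Schwarzian has no quotients, and powers of \<open>f'\<close> are single-valued.
\<close>
lemma locally_univalent_log_deriv:
  assumes f: "f analytic_on unit_disc" and lu: "locally_univalent_on f unit_disc"
  obtains g where "g holomorphic_on unit_disc"
    and "\<forall>z\<in>unit_disc. (f has_field_derivative exp (g z)) (at z)"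
    and "\<forall>z\<in>unit_disc. Schwarzian f z = deriv (deriv g) z - 1/2 * (deriv g z)\<^sup>2"
proof -
  have hf: "f holomorphic_on unit_disc"
    using f by (rule analytic_imp_holomorphic)
  have hf': "deriv f holomorphic_on unit_disc"
    using hf by (rule holomorphic_deriv) simp
  have nz: "deriv f z \<noteq> 0" if z: "z \<in> unit_disc" for z
  proof -
    obtain U where U: "open U" "z \<in> U" "U \<subseteq> unit_disc" "inj_on f U"
      using lu z unfolding locally_univalent_on_def univalent_on_def by blast
    show ?thesis
      using holomorphic_injective_imp_regular[OF holomorphic_on_subset[OF hf U(3)] U(1) U(4) U(2)] .
  qed
  obtain g where g: "g holomorphic_on unit_disc" and eg: "\<And>z. z \<in> unit_disc \<Longrightarrow> exp (g z) = deriv f z"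
    using holomorphic_logarithm_exists[OF convex_ball open_ball hf' nz, of 0] by auto
  note dg = holomorphic_derivI[OF g open_ball]
  have g1: "deriv g z = deriv (deriv f) z / deriv f z" if z: "z \<in> unit_disc" for z
  proof -
    have "((\<lambda>z. exp (g z)) has_field_derivative exp (g z) * deriv g z) (at z)"
      by (rule derivative_eq_intros dg z refl | simp)+
    then have "(deriv f has_field_derivative exp (g z) * deriv g z) (at z)"
      by (rule has_field_derivative_transform_within_open[where S = unit_disc])
        (use z eg in auto)
    then have "deriv (deriv f) z = exp (g z) * deriv g z"
      by (rule DERIV_imp_deriv)
    then show ?thesis
      using eg[OF z] nz[OF z] by (simp add: field_simps)
  qed
  have S: "Schwarzian f z = deriv (deriv g) z - 1/2 * (deriv g z)\<^sup>2" if z: "z \<in> unit_disc" for z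
  proof -
    have "eventually (\<lambda>w. w \<in> unit_disc) (nhds z)"
      using z by (intro eventually_nhds_in_open) auto
    then have "eventually (\<lambda>w. deriv (deriv f) w / deriv f w = deriv g w) (nhds z)"
      by eventually_elim (simp add: g1)
    then have "deriv (\<lambda>w. deriv (deriv f) w / deriv f w) z = deriv (deriv g) z"
      by (rule deriv_cong_ev) simp
    then show ?thesis
      unfolding Schwarzian_def using g1[OF z] by simp
  qed
  show ?thesis
  proof (rule that[OF g])
    show "\<forall>z\<in>unit_disc. (f has_field_derivative exp (g z)) (at z)"
      using holomorphic_derivI[OF hf open_ball] eg by simp
  qed (use S in blast)
qed

lemma Schwarzian_holomorphic:
  assumes "f analytic_on unit_disc" "locally_univalent_on f unit_disc"
  shows "Schwarzian f holomorphic_on unit_disc"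
proof -
  obtain g where g: "g holomorphic_on unit_disc"
    and "\<forall>z\<in>unit_disc. (f has_field_derivative exp (g z)) (at z)"
    and S: "\<forall>z\<in>unit_disc. Schwarzian f z = deriv (deriv g) z - 1/2 * (deriv g z)\<^sup>2"
    using locally_univalent_log_deriv[OF assms] by blast
  have "(\<lambda>z. deriv (deriv g) z - 1/2 * (deriv g z)\<^sup>2) holomorphic_on unit_disc"
    by (intro holomorphic_intros holomorphic_deriv[OF holomorphic_deriv[OF g]] holomorphic_deriv[OF g]) auto
  then show ?thesis
    by (rule holomorphic_transform) (use S in simp)
qed

text \<open>
  The function \<open>\<phi> = exp (- g / 2)\<close> is the branch of \<open>(f')\<^sup>-\<^sup>1\<^sup>/\<^sup>2\<close>.  Recording
  \<open>f' = 1 / \<phi>\<^sup>2\<close> rather than a second solution makes it immediate that every \<open>(c\<^sub>1 f + c\<^sub>2) \<phi>\<close> solves the same equation: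
  the terms with \<open>\<phi>'\<close> coming from \<open>f' \<phi>\<close> cancel.
\<close>
lemma Schwarzian_linearization:
  assumes "f analytic_on unit_disc" "locally_univalent_on f unit_disc"
  obtains \<phi> \<phi>' where "\<forall>z\<in>unit_disc. \<phi> z \<noteq> 0 \<and>
    (f has_field_derivative 1 / (\<phi> z)\<^sup>2) (at z) \<and>
    (\<phi> has_field_derivative \<phi>' z) (at z) \<and>
    (\<phi>' has_field_derivative - (Schwarzian f z / 2) * \<phi> z) (at z)"
proof -
  obtain g where g: "g holomorphic_on unit_disc"
    and df: "\<forall>z\<in>unit_disc. (f has_field_derivative exp (g z)) (at z)"
    and S: "\<forall>z\<in>unit_disc. Schwarzian f z = deriv (deriv g) z - 1/2 * (deriv g z)\<^sup>2"
    using locally_univalent_log_deriv[OF assms] by blast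
  have g': "deriv g holomorphic_on unit_disc"
    using g by (rule holomorphic_deriv) simp
  note dg = holomorphic_derivI[OF g open_ball]
  note dg' = holomorphic_derivI[OF g' open_ball]
  show ?thesis
  proof (rule that, intro ballI conjI)
    fix z :: complex assume z: "z \<in> unit_disc"
    have "1 / (exp (- g z / 2))\<^sup>2 = exp (g z)"
      by (simp add: exp_double[symmetric] exp_minus field_simps)
    then show "(f has_field_derivative 1 / (exp (- g z / 2))\<^sup>2) (at z)"
      using df z by simp
    show "((\<lambda>z. exp (- g z / 2)) has_field_derivative - deriv g z / 2 * exp (- g z / 2)) (at z)"
      by (rule derivative_eq_intros dg z refl | simp)+
    show "((\<lambda>z. - deriv g z / 2 * exp (- g z / 2)) has_field_derivative
        - (Schwarzian f z / 2) * exp (- g z / 2)) (at z)"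
      by (rule derivative_eq_intros dg dg' z refl | simp)+
        (simp add: bspec[OF S z] field_simps power2_eq_square)
  qed simp
qed

section \<open>Comparison with a positive solution\<close>

text \<open>
  With \<open>H = Re (cnj V V') - \<bar>V\<bar>\<^sup>2 y' / y\<close> one finds
  \<open>H' = \<bar>V' - V y' / y\<bar>\<^sup>2 + (p - Re q) \<bar>V\<bar>\<^sup>2 \<ge> 0\<close>.  As \<open>H\<close> vanishes at both zeros of \<open>V\<close>, it vanishes
  between them.  But \<open>2 H / y\<^sup>2\<close> is the derivative of \<open>\<bar>V / y\<bar>\<^sup>2\<close>, which is therefore constantly zero.
  The complex coefficient \<open>q\<close> of an equation transported from a geodesic enters only through its real part.
\<close>
lemma Sturm_comparison_complex:
  fixes V V' :: "real \<Rightarrow> complex" and q :: "real \<Rightarrow> complex" and p y y' :: "real \<Rightarrow> real"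
  assumes ypos: "\<And>x. \<bar>x\<bar> < 1 \<Longrightarrow> y x > 0"
    and y: "\<And>x. \<bar>x\<bar> < 1 \<Longrightarrow> (y has_real_derivative y' x) (at x)"
    and y': "\<And>x. \<bar>x\<bar> < 1 \<Longrightarrow> (y' has_real_derivative - p x * y x) (at x)"
    and V: "\<And>x. \<bar>x\<bar> < 1 \<Longrightarrow> (V has_vector_derivative V' x) (at x)"
    and V': "\<And>x. \<bar>x\<bar> < 1 \<Longrightarrow> (V' has_vector_derivative - q x * V x) (at x)"
    and q: "\<And>x. \<bar>x\<bar> < 1 \<Longrightarrow> cmod (q x) \<le> p x"
    and x: "-1 < x1" "x2 < 1" and z: "V x1 = 0" "V x2 = 0"
    and t: "x1 < t" "t < x2"
  shows "V t = 0" "V' t = 0"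
proof -
  \<comment> \<open>Real and imaginary parts turn the argument into calculus of real functions.\<close>
  define R where "R x = Re (V x)" for x
  define I where "I x = Im (V x)" for x
  define R' where "R' x = Re (V' x)" for x
  define I' where "I' x = Im (V' x)" for x
  have dR: "(R has_real_derivative R' x) (at x)" if "\<bar>x\<bar> < 1" for x
    unfolding R_def R'_def has_real_derivative_iff_has_vector_derivative
    using bounded_linear.has_vector_derivative[OF bounded_linear_Re V[OF that]] .
  have dI: "(I has_real_derivative I' x) (at x)" if "\<bar>x\<bar> < 1" for x
    unfolding I_def I'_def has_real_derivative_iff_has_vector_derivative
    using bounded_linear.has_vector_derivative[OF bounded_linear_Im V[OF that]] .
  have dR': "(R' has_real_derivative Re (- q x * V x)) (at x)" if "\<bar>x\<bar> < 1" for x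
    unfolding R'_def has_real_derivative_iff_has_vector_derivative
    using bounded_linear.has_vector_derivative[OF bounded_linear_Re V'[OF that]] .
  have dI': "(I' has_real_derivative Im (- q x * V x)) (at x)" if "\<bar>x\<bar> < 1" for x
    unfolding I'_def has_real_derivative_iff_has_vector_derivative
    using bounded_linear.has_vector_derivative[OF bounded_linear_Im V'[OF that]] .
  define L where "L x = y' x / y x" for x
  have dL: "(L has_real_derivative - p x - (L x)\<^sup>2) (at x)" if x: "\<bar>x\<bar> < 1" for x
  proof -
    have "y x \<noteq> 0" using ypos[OF x] by simp
    then show ?thesis
      unfolding L_def
      by (auto intro!: derivative_eq_intros y[OF x] y'[OF x] simp: diff_divide_distrib power2_eq_square)
  qed
  define H where "H x = R x * R' x + I x * I' x - ((R x)\<^sup>2 + (I x)\<^sup>2) * L x" for x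
  define D where "D x = (R' x - R x * L x)\<^sup>2 + (I' x - I x * L x)\<^sup>2
      + (p x - Re (q x)) * ((R x)\<^sup>2 + (I x)\<^sup>2)" for x
  have dH: "(H has_real_derivative D x) (at x)" if x: "\<bar>x\<bar> < 1" for x
  proof -
    have e: "Re (- q x * V x) = - Re (q x) * R x + Im (q x) * I x"
            "Im (- q x * V x) = - Re (q x) * I x - Im (q x) * R x"
      by (simp_all add: R_def I_def)
    have "(H has_real_derivative (R' x * R' x + Re (- q x * V x) * R x) + (I' x * I' x + Im (- q x * V x) * I x)
        - ((2 * R x * R' x + 2 * I x * I' x) * L x + (- p x - (L x)\<^sup>2) * ((R x)\<^sup>2 + (I x)\<^sup>2))) (at x)"
      unfolding H_def
      by (rule derivative_eq_intros dR[OF x] dI[OF x] dR'[OF x] dI'[OF x] dL[OF x] refl | simp)+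
    then show ?thesis
      unfolding D_def e by (simp add: algebra_simps power2_eq_square)
  qed
  have D: "D x \<ge> 0" if "\<bar>x\<bar> < 1" for x
  proof -
    have "Re (q x) \<le> p x"
      using q[OF that] complex_Re_le_cmod[of "q x"] by linarith
    then show ?thesis unfolding D_def by simp
  qed
  have mono: "H s \<le> H u" if "x1 \<le> s" "s \<le> u" "u \<le> x2" for s u
  proof (rule DERIV_nonneg_imp_nondecreasing[OF that(2)])
    fix v assume "s \<le> v" "v \<le> u"
    then have "\<bar>v\<bar> < 1" using that x by auto
    then show "\<exists>d. DERIV H v :> d \<and> d \<ge> 0" using dH D by blast
  qed
  have "H x1 = 0" "H x2 = 0"
    using z by (auto simp: H_def R_def I_def)
  then have H0: "H s = 0" if "x1 \<le> s" "s \<le> x2" for s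
    using mono[of x1 s] mono[of s x2] that by auto
  define K where "K x = ((R x)\<^sup>2 + (I x)\<^sup>2) / (y x)\<^sup>2" for x
  have dK: "(K has_real_derivative 2 * H x / (y x)\<^sup>2) (at x)" if x: "\<bar>x\<bar> < 1" for x
  proof -
    have "y x \<noteq> 0" using ypos[OF x] by simp
    show ?thesis
      unfolding K_def H_def L_def using \<open>y x \<noteq> 0\<close>
      by (auto intro!: derivative_eq_intros dR[OF x] dI[OF x] y[OF x] simp: field_simps power2_eq_square)
  qed
  have V0: "V s = 0" if s: "x1 < s" "s < x2" for s
  proof -
    have "K s = K x1"
    proof (rule DERIV_isconst_end[where f = K and a = x1 and b = s])
      show "continuous_on {x1..s} K"
        by (rule DERIV_continuous_on[OF has_field_derivative_at_within[OF dK]]) (use s x in auto)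
      show "DERIV K u :> 0" if "x1 < u" "u < s" for u
        using dK[of u] H0[of u] that s x by simp
    qed (use s in auto)
    also have "K x1 = 0" using z by (simp add: K_def R_def I_def)
    finally have "K s = 0" .
    moreover have "y s > 0"
      using s x by (intro ypos) auto
    ultimately have "(R s)\<^sup>2 + (I s)\<^sup>2 = 0"
      unfolding K_def by simp
    then show ?thesis by (simp add: R_def I_def complex_eq_iff sum_power2_eq_zero_iff)
  qed
  show "V t = 0" using V0 t .
  have "((\<lambda>_. 0) has_vector_derivative V' t) (at t)"
    by (rule has_vector_derivative_transform_within_open[OF V, of _ "{x1<..<x2}"])
      (use t x V0 in auto)
  then show "V' t = 0"
    using vector_derivative_unique_at has_vector_derivative_const by blast
qed

section \<open>Geodesics and Nehari's criterion\<close>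

text \<open>
  The image of \<open>(-1, 1)\<close> under \<open>T x = \<omega> (x + i r) / (1 - i r x)\<close> is a hyperbolic geodesic whose point
  nearest to the origin is \<open>T 0\<close>.  A disc automorphism with \<open>0 \<mapsto> z1\<close> and a positive number
  \<open>s \<mapsto> z2\<close> parametrises the geodesic through \<open>z1\<close> and \<open>z2\<close>; shifting the parameter by a real automorphism
  \<open>t \<mapsto> (t + \<tau>) / (1 + \<tau> t)\<close> then moves the nearest point to \<open>0\<close>.
\<close>
lemma hyperbolic_geodesic_centred:
  fixes z1 z2 :: complex
  assumes z: "z1 \<in> unit_disc" "z2 \<in> unit_disc" "z1 \<noteq> z2"
  obtains \<omega> :: complex and r x1 x2 :: real where
    "cmod \<omega> = 1" "\<bar>r\<bar> < 1" "-1 < x1" "x1 < x2" "x2 < 1"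
    "z1 = \<omega> * (x1 + \<i> * r) / (1 - \<i> * r * x1)"
    "z2 = \<omega> * (x2 + \<i> * r) / (1 - \<i> * r * x2)"
proof -
  have n: "cmod z1 < 1" "cmod z2 < 1" using z by auto
  \<comment> \<open>The automorphism is \<open>x \<mapsto> \<eta> (x + \<alpha>) / (1 + cnj \<alpha> x)\<close>: it sends \<open>0\<close> to \<open>z1\<close>, and \<open>\<eta>\<close> is
    chosen so that the preimage \<open>s\<close> of \<open>z2\<close> is positive.\<close>
  define \<zeta> where "\<zeta> = (z2 - z1) / (1 - cnj z1 * z2)"
  have nz: "1 + u * v \<noteq> 0" if "cmod u < 1" "cmod v \<le> 1" for u v :: complex
  proof
    assume "1 + u * v = 0"
    then have "u * v = -1" by (simp only: add_eq_0_iff)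
    then have "cmod u * cmod v = 1" by (metis norm_minus_cancel norm_mult norm_one)
    moreover have "cmod u * cmod v \<le> cmod u" using that by (simp add: mult_left_le)
    ultimately show False using that by linarith
  qed
  have d12: "1 - cnj z1 * z2 \<noteq> 0" using nz[of "- cnj z1" z2] n by simp
  have d11: "1 - cnj z1 * z1 \<noteq> 0" using nz[of "- cnj z1" z1] n by simp
  define s where "s = cmod \<zeta>"
  have "s < 1"
    using Moebius_function_norm_lt_1[OF n, of 0]
    by (simp add: s_def \<zeta>_def Moebius_function_simple)
  have "\<zeta> \<noteq> 0" using d12 z(3) by (simp add: \<zeta>_def)
  then have "s > 0" by (simp add: s_def)
  define \<eta> where "\<eta> = \<zeta> / s"
  have \<eta>: "cmod \<eta> = 1" using \<open>\<zeta> \<noteq> 0\<close> by (simp add: \<eta>_def s_def norm_divide)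
  then have \<eta>\<eta>: "\<eta> * cnj \<eta> = 1" by (simp add: complex_norm_square[symmetric])
  define \<alpha> where "\<alpha> = cnj \<eta> * z1"
  have \<alpha>: "cmod \<alpha> < 1" using n \<eta> by (simp add: \<alpha>_def norm_mult)
  have \<eta>\<alpha>: "\<eta> * \<alpha> = z1" using \<eta>\<eta> by (simp add: \<alpha>_def mult.assoc[symmetric])
  have \<eta>s: "\<eta> * s = \<zeta>" using \<open>s > 0\<close> by (simp add: \<eta>_def)
  have cs: "cnj \<alpha> * s = cnj z1 * \<zeta>" using \<eta>s by (simp add: \<alpha>_def mult.assoc mult.commute)
  have e2: "z2 = \<eta> * (s + \<alpha>) / (1 + cnj \<alpha> * s)"
  proof -
    have a: "(1 - cnj z1 * z2) * (\<zeta> + z1) = z2 * (1 - cnj z1 * z1)"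
      using d12 by (simp add: \<zeta>_def field_simps)
    have b: "(1 - cnj z1 * z2) * (1 + cnj z1 * \<zeta>) = 1 - cnj z1 * z1"
      using d12 by (simp add: \<zeta>_def field_simps)
    have "(1 - cnj z1 * z2) * (z2 * (1 + cnj z1 * \<zeta>)) = (1 - cnj z1 * z2) * (\<zeta> + z1)"
      unfolding a using b by (metis mult.left_commute)
    then have "z2 * (1 + cnj z1 * \<zeta>) = \<zeta> + z1" using d12 by simp
    moreover have "1 + cnj z1 * \<zeta> \<noteq> 0" using b d11 by auto
    ultimately show ?thesis
      by (simp add: distrib_left \<eta>\<alpha> \<eta>s cs eq_divide_eq)
  qed
  have e1: "z1 = \<eta> * (of_real 0 + \<alpha>) / (1 + cnj \<alpha> * of_real 0)" by (simp add: \<eta>\<alpha>)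
  \<comment> \<open>After the shift the parameter \<open>\<alpha>\<close> becomes \<open>\<beta> = (\<tau> + \<alpha>) / (1 + \<alpha> \<tau>)\<close>, and \<open>Re \<beta> = 0\<close> is the
    quadratic equation \<open>k \<tau>\<^sup>2 + m \<tau> + k = 0\<close>.  It has a root in \<open>(-1, 1)\<close> since \<open>m > 2 \<bar>k\<bar>\<close>.\<close>
  define k where "k = Re \<alpha>"
  define m where "m = 1 + (cmod \<alpha>)\<^sup>2"
  have km: "2 * \<bar>k\<bar> < m"
  proof -
    have "\<bar>k\<bar> \<le> cmod \<alpha>" by (simp add: k_def abs_Re_le_cmod)
    moreover have "(1 - cmod \<alpha>)\<^sup>2 > 0" using \<alpha> by simp
    ultimately show ?thesis by (simp add: m_def power2_eq_square algebra_simps)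
  qed
  obtain \<tau> :: real where \<tau>: "-1 < \<tau>" "\<tau> < 1" "k * \<tau>\<^sup>2 + m * \<tau> + k = 0"
  proof -
    have "\<exists>x\<ge>-1. x \<le> 1 \<and> k * x\<^sup>2 + m * x + k = 0"
      using km by (intro IVT') (auto intro!: continuous_intros)
    then obtain x where x: "-1 \<le> x" "x \<le> 1" "k * x\<^sup>2 + m * x + k = 0" by auto
    moreover have "x \<noteq> 1" "x \<noteq> -1" using x(3) km by auto
    ultimately show ?thesis using that[of x] by auto
  qed
  have c\<tau>: "cmod (of_real \<tau>) \<le> 1" "cmod (of_real (-\<tau>)) < 1" using \<tau> by (auto simp del: of_real_minus)
  have d: "1 + \<alpha> * \<tau> \<noteq> 0" "1 + cnj \<alpha> * \<tau> \<noteq> 0" using nz[OF _ c\<tau>(1)] \<alpha> by auto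
  define \<beta> where "\<beta> = (\<tau> + \<alpha>) / (1 + \<alpha> * \<tau>)"
  have \<beta>1: "cmod \<beta> < 1"
    using Moebius_function_norm_lt_1[OF c\<tau>(2) \<alpha>, of 0]
    by (simp add: \<beta>_def Moebius_function_simple mult.commute add.commute)
  have "Re \<beta> = 0"
  proof -
    have "Re ((\<tau> + \<alpha>) * cnj (1 + \<alpha> * \<tau>)) = k * \<tau>\<^sup>2 + m * \<tau> + k"
      unfolding m_def cmod_power2 k_def by (simp add: power2_eq_square algebra_simps)
    then show ?thesis
      using \<tau>(3) by (simp add: \<beta>_def Re_complex_div_eq_0)
  qed
  define r where "r = Im \<beta>"
  have \<beta>r: "\<beta> = \<i> * r" using \<open>Re \<beta> = 0\<close> by (simp add: r_def complex_eq_iff)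
  have r1: "\<bar>r\<bar> < 1" using \<beta>1 abs_Im_le_cmod[of \<beta>] by (simp add: r_def)
  have q1: "\<tau> + \<alpha> = \<i> * r * (1 + \<alpha> * \<tau>)" using \<beta>r d by (simp add: \<beta>_def field_simps)
  have q2: "\<tau> + cnj \<alpha> = - \<i> * r * (1 + cnj \<alpha> * \<tau>)" using arg_cong[OF q1, of cnj] by simp
  define \<omega> where "\<omega> = \<eta> * (1 + \<alpha> * \<tau>) / (1 + cnj \<alpha> * \<tau>)"
  have \<omega>: "cmod \<omega> = 1"
  proof -
    have "cmod (1 + cnj \<alpha> * \<tau>) = cmod (cnj (1 + \<alpha> * \<tau>))" by simp
    then have "cmod (1 + cnj \<alpha> * \<tau>) = cmod (1 + \<alpha> * \<tau>)" by (metis complex_mod_cnj)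
    then show ?thesis using d \<eta> by (simp add: \<omega>_def norm_mult norm_divide)
  qed
  \<comment> \<open>The two parametrisations agree; both fractions are expanded by \<open>1 - \<tau> x\<close> and by the
    denominators of \<open>\<beta>\<close> and \<open>cnj \<beta>\<close>, which leaves the common factor \<open>1 - \<tau>\<^sup>2\<close>.\<close>
  have key: "\<eta> * (x + \<alpha>) / (1 + cnj \<alpha> * x) = \<omega> * (t + \<i> * r) / (1 - \<i> * r * t)"
    if x: "-1 < x" "x < 1" and t: "t = (x - \<tau>) / (1 - \<tau> * x)" for x t :: real
  proof -
    have "\<bar>\<tau> * x\<bar> < 1" using abs_mult_less[of \<tau> 1 x 1] \<tau> x by (simp add: abs_mult)
    then have tx: "1 - \<tau> * x \<noteq> 0" by auto
    then have "t * (1 - \<tau> * x) = x - \<tau>" using t by simp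
    then have tt: "complex_of_real t * (1 - \<tau> * x) = x - \<tau>"
      by (metis of_real_1 of_real_diff of_real_mult)
    have a: "(1 - \<tau> * x) * ((1 + \<alpha> * \<tau>) * (t + \<i> * r)) = (1 - \<tau>\<^sup>2) * (x + \<alpha>)"
    proof -
      have "(1 - \<tau> * x) * ((1 + \<alpha> * \<tau>) * (t + \<i> * r))
          = (1 + \<alpha> * \<tau>) * (complex_of_real t * (1 - \<tau> * x)) + (1 - \<tau> * x) * (\<i> * r * (1 + \<alpha> * \<tau>))"
        by (simp add: algebra_simps)
      also have "\<dots> = (1 + \<alpha> * \<tau>) * (x - \<tau>) + (1 - \<tau> * x) * (\<tau> + \<alpha>)"
        unfolding tt q1[symmetric] by simp
      finally show ?thesis by (simp add: algebra_simps power2_eq_square)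
    qed
    have b: "(1 - \<tau> * x) * ((1 + cnj \<alpha> * \<tau>) * (1 - \<i> * r * t)) = (1 - \<tau>\<^sup>2) * (1 + cnj \<alpha> * x)"
    proof -
      have "(1 - \<tau> * x) * ((1 + cnj \<alpha> * \<tau>) * (1 - \<i> * r * t))
          = (1 - \<tau> * x) * (1 + cnj \<alpha> * \<tau>) + (- \<i> * r * (1 + cnj \<alpha> * \<tau>)) * (complex_of_real t * (1 - \<tau> * x))"
        by (simp add: algebra_simps)
      also have "\<dots> = (1 - \<tau> * x) * (1 + cnj \<alpha> * \<tau>) + (\<tau> + cnj \<alpha>) * (x - \<tau>)"
        unfolding tt q2[symmetric] by simp
      finally show ?thesis by (simp add: algebra_simps power2_eq_square)
    qed
    have "1 - \<tau>\<^sup>2 \<noteq> 0" using \<tau> by (auto simp: power2_eq_1_iff)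
    then have t2: "1 - (complex_of_real \<tau>)\<^sup>2 \<noteq> 0"
      by (metis of_real_1 of_real_diff of_real_eq_0_iff of_real_power)
    have tx': "1 - complex_of_real \<tau> * x \<noteq> 0"
      using tx by (metis of_real_1 of_real_diff of_real_eq_0_iff of_real_mult)
    have "\<omega> * (t + \<i> * r) / (1 - \<i> * r * t)
        = \<eta> * ((1 - \<tau> * x) * ((1 + \<alpha> * \<tau>) * (t + \<i> * r)))
            / ((1 - \<tau> * x) * ((1 + cnj \<alpha> * \<tau>) * (1 - \<i> * r * t)))"
      using tx' by (simp add: \<omega>_def)
    also have "\<dots> = \<eta> * (x + \<alpha>) / (1 + cnj \<alpha> * x)"
      unfolding a b using t2 by simp
    finally show ?thesis ..
  qed
  define x2 where "x2 = (s - \<tau>) / (1 - \<tau> * s)"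
  have ts: "1 - \<tau> * s > 0"
  proof -
    have "\<tau> * s < 1 * 1" using \<tau> \<open>0 < s\<close> \<open>s < 1\<close> by (intro mult_strict_mono) auto
    then show ?thesis by simp
  qed
  have "- \<tau> < x2"
  proof -
    have "\<tau>\<^sup>2 < 1" using \<tau> by (simp add: abs_square_less_1)
    then have "\<tau>\<^sup>2 * s < 1 * s" using \<open>s > 0\<close> by (intro mult_strict_right_mono) auto
    then show ?thesis
      using ts by (simp add: x2_def field_simps power2_eq_square)
  qed
  moreover have "x2 < 1"
  proof -
    have "0 < (1 - s) * (1 + \<tau>)" using \<tau> \<open>s < 1\<close> by simp
    then show ?thesis using ts by (simp add: x2_def field_simps)
  qed
  ultimately show ?thesis
    using that[OF \<omega> r1 _ \<open>- \<tau> < x2\<close> \<open>x2 < 1\<close>] \<tau> e1 e2 key[of 0 "-\<tau>"] key[of s x2] \<open>0 < s\<close> \<open>s < 1\<close>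
    by (simp add: x2_def)
qed

text \<open>
  If \<open>f z1 = f z2\<close>, then \<open>v = (f - f z1) \<phi>\<close> vanishes at both points.  Along the geodesic \<open>T\<close> the function
  \<open>V x = v (T x) / sqrt (T' x)\<close> satisfies \<open>V'' = - q V\<close> with
  \<open>q = T'\<^sup>2 (Sf \<circ> T) / 2\<close>, since \<open>T\<close> has zero Schwarzian; up to a constant factor
  \<open>1 / sqrt (T' x)\<close> is just \<open>1 - i r x\<close>.  The Schwarz-Pick equality
  \<open>(1 - x\<^sup>2) \<bar>T' x\<bar> = 1 - \<bar>T x\<bar>\<^sup>2\<close>, \<open>\<bar>T x\<bar> \<ge> \<bar>x\<bar>\<close> and the monotonicity hypothesis give \<open>\<bar>q\<bar> \<le> p\<close>.
  Comparison forces \<open>v = v' = 0\<close> at an intermediate point, whereas \<open>v' = 1 / \<phi>\<close> wherever \<open>v = 0\<close>.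
\<close>
theorem Nehari_univalence:
  fixes f :: "complex \<Rightarrow> complex" and p y y' :: "real \<Rightarrow> real"
  assumes ypos: "\<And>x. \<bar>x\<bar> < 1 \<Longrightarrow> y x > 0"
    and y: "\<And>x. \<bar>x\<bar> < 1 \<Longrightarrow> (y has_real_derivative y' x) (at x)"
    and y': "\<And>x. \<bar>x\<bar> < 1 \<Longrightarrow> (y' has_real_derivative - p x * y x) (at x)"
    and even: "\<And>x. p (- x) = p x"
    and mono: "\<And>s t. 0 \<le> s \<Longrightarrow> s \<le> t \<Longrightarrow> t < 1 \<Longrightarrow> (1 - t\<^sup>2)\<^sup>2 * p t \<le> (1 - s\<^sup>2)\<^sup>2 * p s"
    and f: "f analytic_on unit_disc" and lu: "locally_univalent_on f unit_disc"
    and S: "\<And>z. z \<in> unit_disc \<Longrightarrow> cmod (Schwarzian f z) \<le> 2 * p (cmod z)"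
  shows "inj_on f unit_disc"
proof (rule inj_onI, rule ccontr)
  fix z1 z2 assume z: "z1 \<in> unit_disc" "z2 \<in> unit_disc" and fz: "f z1 = f z2" and "z1 \<noteq> z2"
  obtain \<phi> \<phi>' where lin: "\<forall>z\<in>unit_disc. \<phi> z \<noteq> 0 \<and>
      (f has_field_derivative 1 / (\<phi> z)\<^sup>2) (at z) \<and>
      (\<phi> has_field_derivative \<phi>' z) (at z) \<and>
      (\<phi>' has_field_derivative - (Schwarzian f z / 2) * \<phi> z) (at z)"
    using Schwarzian_linearization[OF f lu] by blast
  then have \<phi>0: "\<And>z. z \<in> unit_disc \<Longrightarrow> \<phi> z \<noteq> 0"
    and df: "\<And>z. z \<in> unit_disc \<Longrightarrow> (f has_field_derivative 1 / (\<phi> z)\<^sup>2) (at z)"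
    and d\<phi>: "\<And>z. z \<in> unit_disc \<Longrightarrow> (\<phi> has_field_derivative \<phi>' z) (at z)"
    and d\<phi>': "\<And>z. z \<in> unit_disc \<Longrightarrow> (\<phi>' has_field_derivative - (Schwarzian f z / 2) * \<phi> z) (at z)"
    by blast+
  obtain \<omega> :: complex and r x1 x2 :: real where \<omega>: "cmod \<omega> = 1" and r: "\<bar>r\<bar> < 1"
    and x: "-1 < x1" "x1 < x2" "x2 < 1"
    and z1: "z1 = \<omega> * (x1 + \<i> * r) / (1 - \<i> * r * x1)"
    and z2: "z2 = \<omega> * (x2 + \<i> * r) / (1 - \<i> * r * x2)"
    by (rule hyperbolic_geodesic_centred[OF z \<open>z1 \<noteq> z2\<close>])
  define v where "v z = (f z - f z1) * \<phi> z" for z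
  define v' where "v' z = 1 / \<phi> z + (f z - f z1) * \<phi>' z" for z
  have dv: "(v has_field_derivative v' z) (at z)" if "z \<in> unit_disc" for z
    unfolding v_def v'_def
    by (rule derivative_eq_intros df[OF that] d\<phi>[OF that] refl)+
      (use \<phi>0[OF that] in \<open>simp add: power2_eq_square\<close>)
  have dv': "(v' has_field_derivative - (Schwarzian f z / 2) * v z) (at z)" if "z \<in> unit_disc" for z
    unfolding v_def v'_def
    by (rule derivative_eq_intros df[OF that] d\<phi>[OF that] d\<phi>'[OF that] \<phi>0[OF that] refl)+
      (use \<phi>0[OF that] in \<open>simp add: power2_eq_square\<close>)
  define D where "D \<xi> = 1 - \<i> * r * \<xi>" for \<xi> :: complex
  define T where "T \<xi> = \<omega> * (\<xi> + \<i> * r) / D \<xi>" for \<xi>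
  define T' where "T' \<xi> = \<omega> * (1 - r\<^sup>2) / (D \<xi>)\<^sup>2" for \<xi>
  have r2: "r\<^sup>2 < 1" using r by (simp add: abs_square_less_1)
  have nD: "(cmod (D (of_real x)))\<^sup>2 = 1 + r\<^sup>2 * x\<^sup>2" for x :: real
    unfolding D_def cmod_power2 by (simp add: power_mult_distrib)
  have D0: "D (of_real x) \<noteq> 0" for x :: real
  proof
    assume "D (of_real x) = 0"
    then have "1 + (r * x)\<^sup>2 = 0" using nD[of x] by (simp add: power_mult_distrib)
    then show False using zero_le_power2[of "r * x"] by linarith
  qed
  have pos: "1 + r\<^sup>2 * x\<^sup>2 > 0" for x :: real
    by (metis add_pos_nonneg mult_nonneg_nonneg zero_le_power2 zero_less_one)
  have nT: "(cmod (T (of_real x)))\<^sup>2 = (x\<^sup>2 + r\<^sup>2) / (1 + r\<^sup>2 * x\<^sup>2)" for x :: real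
  proof -
    have "(cmod (of_real x + \<i> * r))\<^sup>2 = x\<^sup>2 + r\<^sup>2"
      unfolding cmod_power2 by simp
    then show ?thesis
      using \<omega> by (simp add: T_def norm_mult norm_divide power_mult_distrib power_divide nD)
  qed
  have nT': "cmod (T' (of_real x)) = (1 - r\<^sup>2) / (1 + r\<^sup>2 * x\<^sup>2)" for x :: real
  proof -
    have "cmod (1 - (of_real r)\<^sup>2) = 1 - r\<^sup>2"
      using r2 by (metis abs_of_pos diff_gt_0_iff_gt norm_of_real of_real_1 of_real_diff of_real_power)
    then show ?thesis
      using \<omega> by (simp add: T'_def norm_mult norm_divide norm_power nD)
  qed
  have pick: "(1 - x\<^sup>2) * cmod (T' (of_real x)) = 1 - (cmod (T (of_real x)))\<^sup>2" for x :: real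
    unfolding nT nT' using pos[of x] by (simp add: field_simps)
  have T1: "T (of_real x) \<in> unit_disc" if "\<bar>x\<bar> < 1" for x :: real
  proof -
    have "(1 - x\<^sup>2) * cmod (T' (of_real x)) > 0"
      unfolding nT' using that r2 pos[of x] by (simp add: abs_square_less_1)
    then have "(cmod (T (of_real x)))\<^sup>2 < 1" using pick[of x] by linarith
    then show ?thesis by (simp add: abs_square_less_1)
  qed
  have Tge: "\<bar>x\<bar> \<le> cmod (T (of_real x))" if "\<bar>x\<bar> < 1" for x :: real
  proof -
    have "x\<^sup>2 \<le> 1" using that by (simp add: abs_square_le_1)
    then have "r\<^sup>2 * (x\<^sup>2 * x\<^sup>2) \<le> r\<^sup>2 * 1" by (intro mult_left_mono mult_le_one) auto
    then have "x\<^sup>2 \<le> (cmod (T (of_real x)))\<^sup>2"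
      unfolding nT using pos[of x] by (simp add: field_simps)
    then show ?thesis by (simp add: abs_le_square_iff[symmetric])
  qed
  define V where "V x = D (of_real x) * v (T (of_real x))" for x :: real
  define V' where "V' x = - \<i> * r * v (T (of_real x)) + \<omega> * (1 - r\<^sup>2) / D (of_real x) * v' (T (of_real x))" for x :: real
  define q where "q x = (T' (of_real x))\<^sup>2 * (Schwarzian f (T (of_real x)) / 2)" for x :: real
  have dD: "(D has_field_derivative - \<i> * r) (at \<xi>)" for \<xi>
    unfolding D_def by (auto intro!: derivative_eq_intros)
  have dT: "(T has_field_derivative T' \<xi>) (at \<xi>)" if "D \<xi> \<noteq> 0" for \<xi>
  proof -
    have "(T has_field_derivative (\<omega> * D \<xi> - \<omega> * (\<xi> + \<i> * r) * (- \<i> * r)) / (D \<xi> * D \<xi>)) (at \<xi>)"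
      unfolding T_def using that by (auto intro!: derivative_eq_intros dD)
    moreover have "\<omega> * D \<xi> - \<omega> * (\<xi> + \<i> * r) * (- \<i> * r) = \<omega> * (1 - r\<^sup>2)"
      by (simp add: D_def algebra_simps power2_eq_square)
    ultimately show ?thesis by (simp add: T'_def power2_eq_square)
  qed
  have dV: "(V has_vector_derivative V' x) (at x)" if x: "\<bar>x\<bar> < 1" for x
  proof -
    have "((\<lambda>\<xi>. D \<xi> * v (T \<xi>)) has_field_derivative V' x) (at (of_real x))"
      unfolding V'_def
      by (rule derivative_eq_intros dD dT D0 DERIV_chain2[where g = T, OF dv[OF T1[OF x]]] refl)+
        (use D0[of x] in \<open>simp add: T'_def power2_eq_square\<close>)
    then show ?thesis
      unfolding V_def by (rule has_vector_derivative_real_field)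
  qed
  have dV': "(V' has_vector_derivative - q x * V x) (at x)" if x: "\<bar>x\<bar> < 1" for x
  proof -
    have "((\<lambda>\<xi>. - \<i> * r * v (T \<xi>) + \<omega> * (1 - r\<^sup>2) / D \<xi> * v' (T \<xi>)) has_field_derivative - q x * V x) (at (of_real x))"
      by (rule derivative_eq_intros dD dT D0 DERIV_chain2[where g = T, OF dv[OF T1[OF x]]]
           DERIV_chain2[where g = T, OF dv'[OF T1[OF x]]] refl)+
        (use D0[of x] in \<open>simp add: T'_def q_def V_def field_simps power2_eq_square\<close>)
    then show ?thesis
      unfolding V'_def by (rule has_vector_derivative_real_field)
  qed
  have q: "cmod (q x) \<le> p x" if x: "\<bar>x\<bar> < 1" for x
  proof -
    have x2: "(1 - x\<^sup>2)\<^sup>2 > 0" using x by (auto simp: power2_eq_1_iff)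
    have px: "p \<bar>x\<bar> = p x" using even[of x] by (simp add: abs_if)
    let ?n = "cmod (T (of_real x))"
    have "(1 - x\<^sup>2)\<^sup>2 * cmod (q x) = ((1 - x\<^sup>2) * cmod (T' (of_real x)))\<^sup>2 * (cmod (Schwarzian f (T (of_real x))) / 2)"
      by (simp add: q_def norm_mult norm_power norm_divide power_mult_distrib)
    also have "\<dots> = (1 - ?n\<^sup>2)\<^sup>2 * (cmod (Schwarzian f (T (of_real x))) / 2)"
      unfolding pick ..
    also have "\<dots> \<le> (1 - ?n\<^sup>2)\<^sup>2 * p ?n"
      using S[OF T1[OF x]] by (intro mult_left_mono) auto
    also have "\<dots> \<le> (1 - \<bar>x\<bar>\<^sup>2)\<^sup>2 * p \<bar>x\<bar>"
      using Tge[OF x] T1[OF x] by (intro mono) auto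
    finally show ?thesis using x2 px by simp
  qed
  have V12: "V x1 = 0" "V x2 = 0"
    using z1 z2 fz by (simp_all add: V_def v_def T_def D_def)
  define t where "t = (x1 + x2) / 2"
  have t: "x1 < t" "t < x2" using x by (auto simp: t_def)
  then have t1: "\<bar>t\<bar> < 1" using x by auto
  have "V t = 0" "V' t = 0"
    using Sturm_comparison_complex[OF ypos y y' dV dV' q x(1) x(3) V12 t] by auto
  then have v0: "v (T t) = 0"
    using D0[of t] by (simp add: V_def)
  moreover have "1 - (complex_of_real r)\<^sup>2 \<noteq> 0"
    using r2 by (metis diff_gt_0_iff_gt less_irrefl of_real_1 of_real_diff of_real_eq_0_iff of_real_power)
  moreover have "\<omega> \<noteq> 0"
    using \<omega> by auto
  ultimately have "v' (T t) = 0"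
    using \<open>V' t = 0\<close> D0[of t] by (simp add: V'_def)
  then show False
    using v0 \<phi>0[OF T1[OF t1]] by (simp add: v_def v'_def)
qed

section \<open>Oscillation and failure of univalence\<close>

text \<open>
  The Wronskian \<open>W = U' y - U y'\<close> starts at \<open>0\<close> and, while \<open>U\<close> is positive, decreases, strictly at first; so
  \<open>W \<le> - c < 0\<close> from some point on.  Then \<open>(U / y)' = W / y\<^sup>2 \<le> - c / (K (1 - x))\<close>, and comparison with
  \<open>ln (1 - x)\<close> shows that \<open>U / y\<close> cannot stay positive up to \<open>1\<close>.  The bound \<open>y\<^sup>2 \<le> K (1 - x)\<close> is what
  makes \<open>y\<close> a critical solution at the end point.
\<close>
lemma Sturm_zero_right:
  fixes p Q y y' U U' :: "real \<Rightarrow> real"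
  assumes ypos: "\<And>x. \<bar>x\<bar> < 1 \<Longrightarrow> y x > 0"
    and y: "\<And>x. \<bar>x\<bar> < 1 \<Longrightarrow> (y has_real_derivative y' x) (at x)"
    and y': "\<And>x. \<bar>x\<bar> < 1 \<Longrightarrow> (y' has_real_derivative - p x * y x) (at x)"
    and U: "\<And>x. \<bar>x\<bar> < 1 \<Longrightarrow> (U has_real_derivative U' x) (at x)"
    and U': "\<And>x. \<bar>x\<bar> < 1 \<Longrightarrow> (U' has_real_derivative - Q x * U x) (at x)"
    and Q: "\<And>x. \<bar>x\<bar> < 1 \<Longrightarrow> p x \<le> Q x"
    and K: "K > 0" "\<And>x. \<bar>x\<bar> < 1 \<Longrightarrow> (y x)\<^sup>2 \<le> K * (1 - x)"
    and x0: "\<bar>x0\<bar> < 1" "p x0 < Q x0" "U x0 = y x0" "U' x0 = y' x0"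
  obtains x where "x0 < x" "x < 1" "U x = 0"
proof (rule ccontr)
  assume no_zero: "\<not> thesis"
  note zero_found = that
  have Unz: "U x \<noteq> 0" if "x0 < x" "x < 1" for x
    using zero_found[OF that] no_zero by blast
  have U0: "U x0 > 0" using x0 ypos by simp
  have Upos: "U x > 0" if x: "x0 \<le> x" "x < 1" for x
  proof (rule ccontr)
    assume "\<not> U x > 0"
    moreover have "continuous_on {x0..x} U"
      by (rule DERIV_continuous_on[OF has_field_derivative_at_within[OF U]]) (use x x0 in auto)
    ultimately obtain c where "x0 \<le> c" "c \<le> x" "U c = 0"
      using IVT2'[of U x 0 x0] U0 x by auto
    then show False using Unz[of c] U0 x by (cases "c = x0") auto
  qed
  define W where "W x = U' x * y x - U x * y' x" for x
  have dW: "(W has_real_derivative (p x - Q x) * (U x * y x)) (at x)" if "\<bar>x\<bar> < 1" for x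
  proof -
    have "(W has_real_derivative (- Q x * U x * y x + y' x * U' x) - (U' x * y' x + - p x * y x * U x)) (at x)"
      unfolding W_def by (rule DERIV_diff DERIV_mult U U' y y' that)+
    then show ?thesis by (simp add: algebra_simps)
  qed
  have Wmono: "W v \<le> W u" if "x0 \<le> u" "u \<le> v" "v < 1" for u v
  proof (rule DERIV_nonpos_imp_nonincreasing[OF that(2)])
    fix x assume "u \<le> x" "x \<le> v"
    then have x: "\<bar>x\<bar> < 1" "x0 \<le> x" "x < 1" using that x0 by auto
    have "(p x - Q x) * (U x * y x) \<le> 0"
      using Q[OF x(1)] Upos[OF x(2,3)] ypos[OF x(1)] by (intro mult_nonpos_nonneg) auto
    then show "\<exists>d. DERIV W x :> d \<and> d \<le> 0" using dW[OF x(1)] by blast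
  qed
  have "(p x0 - Q x0) * (U x0 * y x0) < 0"
    using x0 U0 ypos by (intro mult_neg_pos) auto
  then obtain d where d: "d > 0" "\<And>h. 0 < h \<Longrightarrow> h < d \<Longrightarrow> W (x0 + h) < W x0"
    using DERIV_neg_dec_right[OF dW[OF x0(1)]] by blast
  define h where "h = min (d / 2) ((1 - x0) / 2)"
  have h: "0 < h" "h < d" "x0 + h < 1" using d(1) x0(1) by (auto simp: h_def min_def field_simps)
  define x1 where "x1 = x0 + h"
  define c where "c = - W x1"
  have "W x0 = 0" using x0 by (simp add: W_def)
  then have c: "c > 0" using d(2)[OF h(1,2)] by (simp add: c_def x1_def)
  have x1: "x0 < x1" "x1 < 1" "\<bar>x1\<bar> < 1" using h x0(1) by (auto simp: x1_def)
  define R where "R x = U x / y x - c / K * ln (1 - x)" for x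
  have dR: "(R has_real_derivative W x / (y x)\<^sup>2 + c / K * (1 / (1 - x))) (at x)" if x: "\<bar>x\<bar> < 1" for x
  proof -
    have "y x \<noteq> 0" using ypos[OF x] by simp
    have "((\<lambda>x. U x / y x) has_real_derivative W x / (y x)\<^sup>2) (at x)"
      using DERIV_divide[OF U[OF x] y[OF x] \<open>y x \<noteq> 0\<close>] by (simp add: W_def power2_eq_square)
    moreover have "((\<lambda>x. c / K * ln (1 - x)) has_real_derivative c / K * (1 / (1 - x) * - 1)) (at x)"
      by (rule derivative_eq_intros refl | use x in simp)+
    ultimately have "(R has_real_derivative W x / (y x)\<^sup>2 - c / K * (1 / (1 - x) * - 1)) (at x)"
      unfolding R_def by (rule DERIV_diff)
    then show ?thesis by simp
  qed
  have Rmono: "R x \<le> R x1" if x: "x1 \<le> x" "x < 1" for x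
  proof (rule DERIV_nonpos_imp_nonincreasing[OF x(1)])
    fix t assume t: "x1 \<le> t" "t \<le> x"
    then have t1: "\<bar>t\<bar> < 1" using x x1 by auto
    have "W t \<le> - c" using Wmono[of x1 t] t x x1 by (simp add: c_def)
    moreover have y2: "(y t)\<^sup>2 > 0" using ypos[OF t1] by simp
    ultimately have "W t / (y t)\<^sup>2 \<le> - c / (y t)\<^sup>2" by (intro divide_right_mono) auto
    moreover have "c / (K * (1 - t)) \<le> c / (y t)\<^sup>2"
      using K(1) K(2)[OF t1] y2 c t1 by (intro divide_left_mono mult_pos_pos) auto
    ultimately have "W t / (y t)\<^sup>2 + c / K * (1 / (1 - t)) \<le> 0" by simp
    then show "\<exists>d. DERIV R t :> d \<and> d \<le> 0" using dR[OF t1] by blast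
  qed
  define M where "M = U x1 / y x1"
  have M: "M > 0" using Upos[of x1] ypos[of x1] x1 by (simp add: M_def)
  \<comment> \<open>At distance \<open>\<epsilon>\<close> from \<open>1\<close> the logarithm has consumed exactly the value
    \<open>M\<close> that \<open>U / y\<close> had at \<open>x1\<close>.\<close>
  define \<epsilon> where "\<epsilon> = exp (- (M * K / c)) * (1 - x1)"
  define x where "x = 1 - \<epsilon>"
  have "exp (- (M * K / c)) < 1" using M K c by simp
  then have "\<epsilon> < 1 * (1 - x1)"
    unfolding \<epsilon>_def using x1 by (intro mult_strict_right_mono) auto
  moreover have "\<epsilon> > 0" using x1 by (simp add: \<epsilon>_def)
  ultimately have x: "x1 \<le> x" "x < 1" by (simp_all add: x_def)
  have "ln (1 - x) = - (M * K / c) + ln (1 - x1)"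
    using x1 by (simp add: x_def \<epsilon>_def ln_mult)
  then have "R x = U x / y x + M - c / K * ln (1 - x1)"
    using c K by (simp add: R_def field_simps)
  moreover have "R x1 = M - c / K * ln (1 - x1)" by (simp add: R_def M_def)
  moreover have "U x / y x > 0" using Upos[of x] ypos[of x] x x1 by simp
  ultimately show False using Rmono[OF x] by simp
qed

text \<open>
  The zero to the left of \<open>x0\<close> comes from the reflection \<open>x \<mapsto> - x\<close>, which keeps both equations and
  replaces \<open>y'\<close> and \<open>U'\<close> by their negatives.
\<close>
lemma Sturm_two_zeros:
  fixes p Q y y' U U' :: "real \<Rightarrow> real"
  assumes ypos: "\<And>x. \<bar>x\<bar> < 1 \<Longrightarrow> y x > 0"
    and y: "\<And>x. \<bar>x\<bar> < 1 \<Longrightarrow> (y has_real_derivative y' x) (at x)"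
    and y': "\<And>x. \<bar>x\<bar> < 1 \<Longrightarrow> (y' has_real_derivative - p x * y x) (at x)"
    and U: "\<And>x. \<bar>x\<bar> < 1 \<Longrightarrow> (U has_real_derivative U' x) (at x)"
    and U': "\<And>x. \<bar>x\<bar> < 1 \<Longrightarrow> (U' has_real_derivative - Q x * U x) (at x)"
    and Q: "\<And>x. \<bar>x\<bar> < 1 \<Longrightarrow> p x \<le> Q x"
    and K: "K > 0" "\<And>x. \<bar>x\<bar> < 1 \<Longrightarrow> (y x)\<^sup>2 \<le> K * (1 - \<bar>x\<bar>)"
    and x0: "\<bar>x0\<bar> < 1" "p x0 < Q x0" "U x0 = y x0" "U' x0 = y' x0"
  obtains s t where "-1 < s" "s < t" "t < 1" "U s = 0" "U t = 0"
proof -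
  have K': "(y x)\<^sup>2 \<le> K * (1 - x)" if "\<bar>x\<bar> < 1" for x
  proof -
    have "K * (1 - \<bar>x\<bar>) \<le> K * (1 - x)" using K(1) by (intro mult_left_mono) auto
    then show ?thesis using K(2)[OF that] by linarith
  qed
  obtain t where t: "x0 < t" "t < 1" "U t = 0"
    by (rule Sturm_zero_right[OF ypos y y' U U' Q K(1) K' x0])
  have refl1: "((\<lambda>x. F (- x)) has_real_derivative - F' (- x)) (at x)"
    if "\<And>x. \<bar>x\<bar> < 1 \<Longrightarrow> (F has_real_derivative F' x) (at x)" "\<bar>x\<bar> < 1" for F F' and x :: real
  proof -
    have "((\<lambda>x. F (- x)) has_real_derivative F' (- x) * - 1) (at x)"
      by (rule DERIV_chain2[where g = uminus, OF that(1)])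
        (use that(2) in \<open>auto intro!: derivative_eq_intros\<close>)
    then show ?thesis by simp
  qed
  have refl2: "((\<lambda>x. - F' (- x)) has_real_derivative - q (- x) * F (- x)) (at x)"
    if "\<And>x. \<bar>x\<bar> < 1 \<Longrightarrow> (F' has_real_derivative - q x * F x) (at x)" "\<bar>x\<bar> < 1" for F F' q and x :: real
    using DERIV_minus[OF refl1[of F' "\<lambda>x. - q x * F x", OF that]] by simp
  obtain s where s: "- x0 < s" "s < 1" "U (- s) = 0"
  proof (rule Sturm_zero_right[of "\<lambda>x. y (- x)" "\<lambda>x. - y' (- x)" "\<lambda>x. p (- x)"
        "\<lambda>x. U (- x)" "\<lambda>x. - U' (- x)" "\<lambda>x. Q (- x)" K "- x0"])
    show "(y (- x))\<^sup>2 \<le> K * (1 - x)" if "\<bar>x\<bar> < 1" for x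
    proof -
      have "K * (1 - \<bar>- x\<bar>) \<le> K * (1 - x)" using K(1) by (intro mult_left_mono) auto
      then show ?thesis using K(2)[of "- x"] that by simp
    qed
  qed (use ypos Q K(1) x0 refl1[OF y] refl1[OF U] refl2[OF y'] refl2[OF U'] in auto)
  show ?thesis
    using that[of "- s" t] s t by auto
qed

text \<open>
  Among the complex solutions \<open>(c\<^sub>1 f + c\<^sub>2) \<phi>\<close> one has the initial data of \<open>y\<close> at \<open>x0\<close>.  Its real part \<open>U\<close>
  on the axis solves the same equation, because \<open>Sf\<close> is real there, and has two zeros.  The Wronskians of \<open>U\<close>
  with \<open>\<phi>\<close> and with \<open>f \<phi>\<close> are constants \<open>k1\<close>, \<open>k2\<close>, and solving for \<open>U\<close> gives
  \<open>U = \<phi> (k2 - k1 f)\<close>.  So \<open>f\<close> takes the value \<open>k2 / k1\<close> at both zeros.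
\<close>
theorem Schwarzian_not_univalent:
  fixes f :: "complex \<Rightarrow> complex" and p y y' :: "real \<Rightarrow> real"
  assumes ypos: "\<And>x. \<bar>x\<bar> < 1 \<Longrightarrow> y x > 0"
    and y: "\<And>x. \<bar>x\<bar> < 1 \<Longrightarrow> (y has_real_derivative y' x) (at x)"
    and y': "\<And>x. \<bar>x\<bar> < 1 \<Longrightarrow> (y' has_real_derivative - p x * y x) (at x)"
    and K: "K > 0" "\<And>x. \<bar>x\<bar> < 1 \<Longrightarrow> (y x)\<^sup>2 \<le> K * (1 - \<bar>x\<bar>)"
    and f: "f analytic_on unit_disc" and lu: "locally_univalent_on f unit_disc"
    and Sreal: "\<And>x. \<bar>x\<bar> < 1 \<Longrightarrow> Schwarzian f (of_real x) \<in> \<real>"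
    and S: "\<And>x. \<bar>x\<bar> < 1 \<Longrightarrow> 2 * p x \<le> Re (Schwarzian f (of_real x))"
    and x0: "\<bar>x0\<bar> < 1" "2 * p x0 < Re (Schwarzian f (of_real x0))"
  shows "\<not> inj_on f unit_disc"
proof
  assume inj: "inj_on f unit_disc"
  obtain \<phi> \<phi>' where lin: "\<forall>z\<in>unit_disc. \<phi> z \<noteq> 0 \<and>
      (f has_field_derivative 1 / (\<phi> z)\<^sup>2) (at z) \<and>
      (\<phi> has_field_derivative \<phi>' z) (at z) \<and>
      (\<phi>' has_field_derivative - (Schwarzian f z / 2) * \<phi> z) (at z)"
    using Schwarzian_linearization[OF f lu] by blast
  then have \<phi>0: "\<And>z. z \<in> unit_disc \<Longrightarrow> \<phi> z \<noteq> 0"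
    and df: "\<And>z. z \<in> unit_disc \<Longrightarrow> (f has_field_derivative 1 / (\<phi> z)\<^sup>2) (at z)"
    and d\<phi>: "\<And>z. z \<in> unit_disc \<Longrightarrow> (\<phi> has_field_derivative \<phi>' z) (at z)"
    and d\<phi>': "\<And>z. z \<in> unit_disc \<Longrightarrow> (\<phi>' has_field_derivative - (Schwarzian f z / 2) * \<phi> z) (at z)"
    by blast+
  define u where "u c1 c2 z = (c1 * f z + c2) * \<phi> z" for c1 c2 z
  define u' where "u' c1 c2 z = c1 / \<phi> z + (c1 * f z + c2) * \<phi>' z" for c1 c2 z
  have du: "(u c1 c2 has_field_derivative u' c1 c2 z) (at z)" if "z \<in> unit_disc" for c1 c2 z
    unfolding u_def u'_def
    by (rule derivative_eq_intros df[OF that] d\<phi>[OF that] refl)+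
      (use \<phi>0[OF that] in \<open>simp add: power2_eq_square\<close>)
  have du': "(u' c1 c2 has_field_derivative - (Schwarzian f z / 2) * u c1 c2 z) (at z)"
    if "z \<in> unit_disc" for c1 c2 z
    unfolding u_def u'_def
    by (rule derivative_eq_intros df[OF that] d\<phi>[OF that] d\<phi>'[OF that] \<phi>0[OF that] refl)+
      (use \<phi>0[OF that] in \<open>simp add: power2_eq_square\<close>)
  have disc: "complex_of_real x \<in> unit_disc" if "\<bar>x\<bar> < 1" for x using that by simp
  define Q where "Q x = Re (Schwarzian f (of_real x)) / 2" for x
  have SQ: "Schwarzian f (of_real x) = of_real (2 * Q x)" if "\<bar>x\<bar> < 1" for x
    using Sreal[OF that] by (simp add: Q_def complex_is_Real_iff complex_eq_iff)
  define \<zeta> where "\<zeta> = complex_of_real x0"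
  have \<zeta>: "\<zeta> \<in> unit_disc" using x0 by (simp add: \<zeta>_def)
  \<comment> \<open>These constants solve the two linear equations \<open>u = y x0\<close> and \<open>u' = y' x0\<close> at \<open>\<zeta> = x0\<close>.\<close>
  define c1 where "c1 = \<phi> \<zeta> * (y' x0 - y x0 / \<phi> \<zeta> * \<phi>' \<zeta>)"
  define c2 where "c2 = y x0 / \<phi> \<zeta> - c1 * f \<zeta>"
  have init: "u c1 c2 \<zeta> = y x0" "u' c1 c2 \<zeta> = y' x0"
    using \<phi>0[OF \<zeta>] by (simp_all add: u_def u'_def c2_def) (simp add: c1_def)
  define U where "U x = Re (u c1 c2 (of_real x))" for x
  define U' where "U' x = Re (u' c1 c2 (of_real x))" for x
  have dU: "(U has_real_derivative U' x) (at x)" if "\<bar>x\<bar> < 1" for x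
    unfolding U_def U'_def
    by (rule has_field_derivative_Re has_vector_derivative_real_field du disc that)+
  have dU': "(U' has_real_derivative - Q x * U x) (at x)" if "\<bar>x\<bar> < 1" for x
  proof -
    have "(U' has_real_derivative Re (- (Schwarzian f (of_real x) / 2) * u c1 c2 (of_real x))) (at x)"
      unfolding U'_def
      by (rule has_field_derivative_Re has_vector_derivative_real_field du' disc that)+
    then show ?thesis by (simp add: SQ[OF that] U_def)
  qed
  obtain s t where st: "-1 < s" "s < t" "t < 1" "U s = 0" "U t = 0"
  proof (rule Sturm_two_zeros[OF ypos y y' dU dU' _ K x0(1)])
    show "p x \<le> Q x" if "\<bar>x\<bar> < 1" for x using S[OF that] by (simp add: Q_def)
    show "p x0 < Q x0" using x0(2) by (simp add: Q_def)
    show "U x0 = y x0" "U' x0 = y' x0" using init by (auto simp: U_def U'_def \<zeta>_def)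
  qed
  define k where "k d1 d2 x = of_real (U x) * u' d1 d2 (of_real x) - of_real (U' x) * u d1 d2 (of_real x)"
    for d1 d2 and x :: real
  have dk: "(k d1 d2 has_vector_derivative 0) (at x)" if x: "\<bar>x\<bar> < 1" for d1 d2 x
  proof -
    note v = has_vector_derivative_mult has_vector_derivative_diff has_vector_derivative_of_real
      has_vector_derivative_real_field du du' disc x dU dU'
      has_real_derivative_iff_has_vector_derivative[THEN iffD1]
    have "(k d1 d2 has_vector_derivative
        (of_real (U x) * (- (Schwarzian f (of_real x) / 2) * u d1 d2 (of_real x)) + of_real (U' x) * u' d1 d2 (of_real x))
        - (of_real (U' x) * u' d1 d2 (of_real x) + of_real (- Q x * U x) * u d1 d2 (of_real x))) (at x)"
      unfolding k_def by (rule v)+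
    then show ?thesis by (simp add: SQ[OF x])
  qed
  have kc: "\<exists>c. \<forall>x\<in>{-1<..<1}. k d1 d2 x = c" for d1 d2
    using has_vector_derivative_zero_constant[of "{-1<..<1}" "k d1 d2"] dk has_vector_derivative_at_within
    by (metis abs_less_iff convex_real_interval(8) greaterThanLessThan_iff minus_less_iff)
  obtain k1 where k1: "\<And>x. \<bar>x\<bar> < 1 \<Longrightarrow> k 0 1 x = k1" using kc[of 0 1] by force
  obtain k2 where k2: "\<And>x. \<bar>x\<bar> < 1 \<Longrightarrow> k 1 0 x = k2" using kc[of 1 0] by force
  have Uf: "of_real (U x) = \<phi> (of_real x) * (k2 - k1 * f (of_real x))" if x: "\<bar>x\<bar> < 1" for x
    unfolding k1[OF x, symmetric] k2[OF x, symmetric] using \<phi>0[OF disc[OF x]]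
    by (simp add: k_def u_def u'_def field_simps)
  have s1: "\<bar>s\<bar> < 1" and t1: "\<bar>t\<bar> < 1" using st by auto
  have e: "k2 = k1 * f (of_real s)" "k2 = k1 * f (of_real t)"
    using Uf[OF s1] Uf[OF t1] st \<phi>0[OF disc[OF s1]] \<phi>0[OF disc[OF t1]] by auto
  have "k1 \<noteq> 0"
  proof
    assume "k1 = 0"
    then have "U x0 = 0" using Uf[OF x0(1)] e by simp
    then show False using init ypos[OF x0(1)] by (simp add: U_def \<zeta>_def)
  qed
  then have "f (of_real s) = f (of_real t)" using e by simp
  then have "complex_of_real s = of_real t"
    using inj disc[OF s1] disc[OF t1] by (auto dest: inj_onD)
  then show False using st by simp
qed

section \<open>The coefficient p and its positive solution\<close>

text \<open>
  The left-hand side is \<open>- (L' + L\<^sup>2)\<close> for \<open>L = - 2 a x / (1 - x\<^sup>2) - 2 b x / (1 + x\<^sup>2)\<close>, the logarithmic derivative of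
  \<open>(1 - x\<^sup>2)\<^sup>a (1 + x\<^sup>2)\<^sup>-\<^sup>b\<close>.  The partial fractions of the mixed term of \<open>L\<^sup>2\<close> account for the
  summands \<open>4 a b\<close> in \<open>p\<close>.  Stated over any real field, the identity serves the real equation
  for \<open>y\<close> as well as the Schwarzian of the extremal function.
\<close>
lemma pfun_log_derivative:
  fixes x :: "'a :: real_field" and a b :: real
  assumes "1 - x\<^sup>2 \<noteq> 0" "1 + x\<^sup>2 \<noteq> 0"
  defines "\<alpha> \<equiv> of_real a" and "\<beta> \<equiv> of_real b"
  shows "2 * \<alpha> * (1 + x\<^sup>2) / (1 - x\<^sup>2)\<^sup>2 + 2 * \<beta> * (1 - x\<^sup>2) / (1 + x\<^sup>2)\<^sup>2
    - (2 * \<alpha> * x / (1 - x\<^sup>2) + 2 * \<beta> * x / (1 + x\<^sup>2))\<^sup>2 = pfun a b x"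
proof -
  define u where "u = 1 - x\<^sup>2"
  define v where "v = 1 + x\<^sup>2"
  have uv: "u \<noteq> 0" "v \<noteq> 0" using assms by (auto simp: u_def v_def)
  have "8 * x\<^sup>2 / (u * v) = 4 * (v - u) / (u * v)"
    by (simp add: u_def v_def)
  also have "\<dots> = 4 * u / u\<^sup>2 - 4 * v / v\<^sup>2"
    using uv by (simp add: field_simps power2_eq_square)
  finally have pf: "8 * x\<^sup>2 / (u * v) = 4 * u / u\<^sup>2 - 4 * v / v\<^sup>2" .
  have "(2 * \<alpha> * x / u + 2 * \<beta> * x / v)\<^sup>2
      = 4 * \<alpha>\<^sup>2 * x\<^sup>2 / u\<^sup>2 + 4 * \<beta>\<^sup>2 * x\<^sup>2 / v\<^sup>2 + \<alpha> * \<beta> * (8 * x\<^sup>2 / (u * v))"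
    by (simp add: power2_sum power_divide power_mult_distrib) (simp add: power2_eq_square)
  also have "\<dots> = (4 * \<alpha>\<^sup>2 * x\<^sup>2 + 4 * \<alpha> * \<beta> * u) / u\<^sup>2 + (4 * \<beta>\<^sup>2 * x\<^sup>2 - 4 * \<alpha> * \<beta> * v) / v\<^sup>2"
    unfolding pf by (simp add: add_divide_distrib diff_divide_distrib algebra_simps)
  finally have sq: "(2 * \<alpha> * x / u + 2 * \<beta> * x / v)\<^sup>2
      = (4 * \<alpha>\<^sup>2 * x\<^sup>2 + 4 * \<alpha> * \<beta> * u) / u\<^sup>2 + (4 * \<beta>\<^sup>2 * x\<^sup>2 - 4 * \<alpha> * \<beta> * v) / v\<^sup>2" .
  have n1: "of_real (2*a - 4*a*b) + x\<^sup>2 * of_real (2*a + 4*a*b - 4*a\<^sup>2)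
      = 2 * \<alpha> * v - (4 * \<alpha>\<^sup>2 * x\<^sup>2 + 4 * \<alpha> * \<beta> * u)"
    by (simp add: \<alpha>_def \<beta>_def u_def v_def algebra_simps)
  have n2: "of_real (2*b + 4*a*b) + x\<^sup>2 * of_real (- 2*b - 4*b\<^sup>2 + 4*a*b)
      = 2 * \<beta> * u - (4 * \<beta>\<^sup>2 * x\<^sup>2 - 4 * \<alpha> * \<beta> * v)"
    by (simp add: \<alpha>_def \<beta>_def u_def v_def algebra_simps)
  show ?thesis
    unfolding pfun_def n1 n2 unfolding u_def[symmetric] v_def[symmetric] sq
    by (simp add: diff_divide_distrib)
qed

lemma pfun_of_real: "pfun a b (of_real x) = of_real (pfun a b x)"
  by (simp add: pfun_def)

text \<open>
  The positive solution \<open>y\<close> of \<open>y'' = - p y\<close>.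
\<close>
definition ysol :: "real \<Rightarrow> real \<Rightarrow> real \<Rightarrow> real" where
  "ysol a b x = (1 - x\<^sup>2) powr a * (1 + x\<^sup>2) powr - b"

definition ysol_deriv :: "real \<Rightarrow> real \<Rightarrow> real \<Rightarrow> real" where
  "ysol_deriv a b x = - (2 * a * x / (1 - x\<^sup>2) + 2 * b * x / (1 + x\<^sup>2)) * ysol a b x"

lemma one_minus_square_pos: "\<bar>x\<bar> < 1 \<Longrightarrow> 1 - x\<^sup>2 > 0" for x :: real
  by (simp add: abs_square_less_1)

lemma one_plus_square_pos: "1 + x\<^sup>2 > 0" for x :: real
  by (simp add: add_pos_nonneg)

lemma ysol_pos: "\<bar>x\<bar> < 1 \<Longrightarrow> ysol a b x > 0"
  using one_minus_square_pos[of x] one_plus_square_pos[of x] by (auto simp: ysol_def)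

lemma has_real_derivative_powr_log:
  assumes "(h has_real_derivative h') (at x)" "h x > 0"
  shows "((\<lambda>x. h x powr c) has_real_derivative c * h' / h x * h x powr c) (at x)"
proof -
  have "((\<lambda>x. h x powr c) has_real_derivative c * (h x powr (c - 1)) * h') (at x)"
    using has_real_derivative_powr[OF assms(2), of c] assms(1)
    by (rule DERIV_chain2)
  then show ?thesis using assms(2) by (simp add: powr_diff ac_simps)
qed

lemma ysol_has_derivative:
  assumes "\<bar>x\<bar> < 1"
  shows "(ysol a b has_real_derivative ysol_deriv a b x) (at x)"
proof -
  note p = one_minus_square_pos[OF assms] one_plus_square_pos[of x]
  have 1: "((\<lambda>x. 1 - x\<^sup>2) has_real_derivative - (2 * x)) (at x)"
          "((\<lambda>x. 1 + x\<^sup>2) has_real_derivative 2 * x) (at x)"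
    by (auto intro!: derivative_eq_intros)
  have "(ysol a b has_real_derivative
      (a * - (2 * x) / (1 - x\<^sup>2) * (1 - x\<^sup>2) powr a) * (1 + x\<^sup>2) powr - b
      + (- b * (2 * x) / (1 + x\<^sup>2) * (1 + x\<^sup>2) powr - b) * (1 - x\<^sup>2) powr a) (at x)"
    unfolding ysol_def
    by (rule DERIV_mult has_real_derivative_powr_log 1 p)+
  then show ?thesis
    by (simp add: ysol_deriv_def ysol_def algebra_simps)
qed

lemma ysol_ode:
  assumes "\<bar>x\<bar> < 1"
  shows "(ysol_deriv a b has_real_derivative - pfun a b x * ysol a b x) (at x)"
proof -
  note p = one_minus_square_pos[OF assms] one_plus_square_pos[of x]
  let ?L = "\<lambda>x::real. 2 * a * x / (1 - x\<^sup>2) + 2 * b * x / (1 + x\<^sup>2)"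
  let ?L' = "2 * a * (1 + x\<^sup>2) / (1 - x\<^sup>2)\<^sup>2 + 2 * b * (1 - x\<^sup>2) / (1 + x\<^sup>2)\<^sup>2"
  have "((\<lambda>x. 2 * a * x / (1 - x\<^sup>2)) has_real_derivative 2 * a * (1 + x\<^sup>2) / (1 - x\<^sup>2)\<^sup>2) (at x)"
    using p(1) by (auto intro!: derivative_eq_intros simp: power2_eq_square algebra_simps)
  moreover have "((\<lambda>x. 2 * b * x / (1 + x\<^sup>2)) has_real_derivative 2 * b * (1 - x\<^sup>2) / (1 + x\<^sup>2)\<^sup>2) (at x)"
    using p(2) by (auto intro!: derivative_eq_intros simp: power2_eq_square algebra_simps)
  ultimately have dL: "(?L has_real_derivative ?L') (at x)"
    by (rule DERIV_add)
  have "(ysol_deriv a b has_real_derivative - ?L' * ysol a b x + ysol_deriv a b x * - ?L x) (at x)"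
    unfolding ysol_deriv_def
    by (rule DERIV_mult DERIV_minus dL ysol_has_derivative[OF assms, unfolded ysol_deriv_def])+
  moreover have "- ?L' * ysol a b x + ysol_deriv a b x * - ?L x = - (?L' - (?L x)\<^sup>2) * ysol a b x"
    by (simp add: ysol_deriv_def algebra_simps power2_eq_square)
  moreover have "?L' - (?L x)\<^sup>2 = pfun a b x"
    using pfun_log_derivative[of x a b] p by simp
  ultimately show ?thesis by simp
qed

text \<open>
  This is where \<open>a \<ge> 1/2\<close> enters: \<open>y\<^sup>2\<close> vanishes at the end points at least to first order, so
  \<open>1 / y\<^sup>2\<close> is not integrable.
\<close>
lemma ysol_square_le:
  assumes ab: "1/2 \<le> a" "- 1/2 \<le> b" and x: "\<bar>x\<bar> < 1"
  shows "(ysol a b x)\<^sup>2 \<le> 4 * (1 - x)"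
proof -
  note p = one_minus_square_pos[OF x] one_plus_square_pos[of x]
  have "(ysol a b x)\<^sup>2 = (1 - x\<^sup>2) powr (2 * a) * (1 + x\<^sup>2) powr (- 2 * b)"
    by (simp add: ysol_def power2_eq_square powr_add[symmetric] algebra_simps)
  also have "\<dots> \<le> (1 - x\<^sup>2) powr 1 * (1 + x\<^sup>2) powr 1"
    using p ab by (intro mult_mono powr_mono powr_mono') auto
  also have "\<dots> = (1 - x\<^sup>2) * (1 + x\<^sup>2)" using p by simp
  also have "\<dots> \<le> (1 - x\<^sup>2) * 2" using p by (intro mult_left_mono) auto
  also have "\<dots> = (1 - x) * (2 * (1 + x))" by (simp add: algebra_simps power2_eq_square)
  also have "\<dots> \<le> (1 - x) * 4" using x by (intro mult_left_mono) auto
  finally show ?thesis by simp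
qed

text \<open>
  The lower bound for \<open>b\<close> is the larger root of \<open>2 b\<^sup>2 + (5 + 4 a) b + 2 a\<^sup>2 - a\<close>, so above it this quadratic is
  nonnegative; \<open>25 + 48 a\<close> is its discriminant.  The root itself is at least \<open>1/2 - a\<close>, because \<open>sqrt (25 + 48 a) \<ge> 7\<close>.
\<close>
lemma admissible_lower_bound:
  fixes a b :: real
  assumes a: "1/2 \<le> a" "a \<le> 1" and b: "1/4 * (- (5 + 4*a) + sqrt (25 + 48*a)) \<le> b"
  shows "- 1/2 \<le> b" "2*a - 4*a\<^sup>2 - 8*a*b - 10*b - 4*b\<^sup>2 \<le> 0"
proof -
  have "sqrt (7\<^sup>2) \<le> sqrt (25 + 48 * a)" using a by (intro real_sqrt_le_mono) simp
  then have s7: "7 \<le> sqrt (25 + 48 * a)" by simp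
  have le: "sqrt (25 + 48 * a) \<le> 4 * b + (5 + 4 * a)" using b by simp
  then have "(sqrt (25 + 48 * a))\<^sup>2 \<le> (4 * b + (5 + 4 * a))\<^sup>2" using s7 a by (intro power_mono) auto
  then show "2*a - 4*a\<^sup>2 - 8*a*b - 10*b - 4*b\<^sup>2 \<le> 0"
    using a by (simp add: power2_eq_square algebra_simps)
  show "- 1/2 \<le> b" using s7 le a by simp
qed

text \<open>
  With \<open>\<sigma> = x\<^sup>2\<close> and \<open>u = (1 - \<sigma>) / (1 + \<sigma>)\<close> the derivative of \<open>(1 - x\<^sup>2)\<^sup>2 p\<close> with respect to \<open>\<sigma>\<close> is a cubic \<open>Q u\<close>.
  Its value at \<open>u = 0\<close> is \<open>2 a (1 + 2 b - 2 a) \<le> 0\<close> by the upper bound for \<open>b\<close>, and its value at \<open>u = 1\<close>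
  is nonpositive by the lower bound.  If \<open>b \<ge> 0\<close>, all coefficients of \<open>Q\<close> are nonpositive; if \<open>b < 0\<close>, all but the
  constant one are nonnegative, so \<open>Q\<close> is largest at \<open>u = 1\<close>.
\<close>
lemma pfun_weighted_antimono:
  fixes a b s t :: real
  assumes a: "1/2 \<le> a" "a \<le> 1"
    and b: "1/4 * (- (5 + 4*a) + sqrt (25 + 48*a)) \<le> b" "b \<le> a - 1/2"
    and st: "0 \<le> s" "s \<le> t" "t < 1"
  shows "(1 - t\<^sup>2)\<^sup>2 * pfun a b t \<le> (1 - s\<^sup>2)\<^sup>2 * pfun a b s"
proof -
  define A where "A = 2*a - 4*a*b"
  define B where "B = 2*a + 4*a*b - 4*a\<^sup>2"
  define C where "C = 2*b + 4*a*b"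
  define D where "D = - 2*b - 4*b\<^sup>2 + 4*a*b"
  define u where "u \<sigma> = (1 - \<sigma>) / (1 + \<sigma>)" for \<sigma> :: real
  define P where "P \<sigma> = A + B * \<sigma> + (C + D * \<sigma>) * (u \<sigma>)\<^sup>2" for \<sigma>
  define Q where "Q v = B - 4*b*(2*a-b) * v - b*(6 + 4*b + 4*a) * v\<^sup>2 - 4*b*(1+b) * v^3" for v :: real
  have Pp: "(1 - x\<^sup>2)\<^sup>2 * pfun a b x = P (x\<^sup>2)" if "\<bar>x\<bar> < 1" for x
    using one_minus_square_pos[OF that] one_plus_square_pos[of x]
    by (simp add: P_def u_def pfun_def A_def B_def C_def D_def power_divide field_simps)
  have dP: "(P has_real_derivative Q (u \<sigma>)) (at \<sigma>)" if "\<sigma> \<ge> 0" for \<sigma>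
  proof -
    have du: "(u has_real_derivative - (1 + u \<sigma>)\<^sup>2 / 2) (at \<sigma>)"
      unfolding u_def using that
      by (auto intro!: derivative_eq_intros simp: power2_eq_square divide_simps)
    have s: "\<sigma> * (1 + u \<sigma>) = 1 - u \<sigma>" using that by (simp add: u_def field_simps)
    have "(P has_real_derivative B + (D * (u \<sigma>)\<^sup>2 + (2 * u \<sigma> * (- (1 + u \<sigma>)\<^sup>2 / 2)) * (C + D * \<sigma>))) (at \<sigma>)"
      unfolding P_def by (rule derivative_eq_intros du refl | simp)+
    moreover have "(2 * u \<sigma> * (- (1 + u \<sigma>)\<^sup>2 / 2)) * (C + D * \<sigma>)
        = - (u \<sigma> * (1 + u \<sigma>) * (C * (1 + u \<sigma>) + D * (\<sigma> * (1 + u \<sigma>))))"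
      by (simp add: power2_eq_square field_simps)
    ultimately have "(P has_real_derivative B + (D * (u \<sigma>)\<^sup>2
        + - (u \<sigma> * (1 + u \<sigma>) * (C * (1 + u \<sigma>) + D * (1 - u \<sigma>))))) (at \<sigma>)"
      by (simp only: s)
    moreover have "B + (D * v\<^sup>2 + - (v * (1 + v) * (C * (1 + v) + D * (1 - v)))) = Q v" for v
      by (simp add: Q_def C_def D_def power2_eq_square power3_eq_cube algebra_simps)
    ultimately show ?thesis by (simp only:)
  qed
  note lb = admissible_lower_bound[OF a b(1)]
  have B: "B \<le> 0"
  proof -
    have "a * (1 + 2 * b - 2 * a) \<le> 0"
      using a b by (intro mult_nonneg_nonpos) auto
    then show ?thesis by (simp add: B_def algebra_simps power2_eq_square)
  qed
  have Q: "Q v \<le> 0" if v: "0 \<le> v" "v \<le> 1" for v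
  proof (cases "b \<ge> 0")
    case True
    have "4*b*(2*a-b) * v \<ge> 0" "b*(6 + 4*b + 4*a) * v\<^sup>2 \<ge> 0" "4*b*(1+b) * v^3 \<ge> 0"
      using True v a b by (auto intro!: mult_nonneg_nonneg)
    then show ?thesis using B unfolding Q_def by linarith
  next
    case False
    have "- (4*b*(2*a-b)) * v \<le> - (4*b*(2*a-b)) * 1"
      using False v a b by (intro mult_left_mono) (auto intro!: mult_nonpos_nonneg)
    moreover have "- (b*(6 + 4*b + 4*a)) * v\<^sup>2 \<le> - (b*(6 + 4*b + 4*a)) * 1"
      using False v a lb by (intro mult_left_mono) (auto intro!: mult_nonpos_nonneg simp: power_le_one)
    moreover have "- (4*b*(1+b)) * v^3 \<le> - (4*b*(1+b)) * 1"
      using False v a lb by (intro mult_left_mono) (auto intro!: mult_nonpos_nonneg simp: power_le_one)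
    ultimately have "Q v \<le> Q 1" by (simp add: Q_def)
    also have "Q 1 = 2*a - 4*a\<^sup>2 - 8*a*b - 10*b - 4*b\<^sup>2"
      by (simp add: Q_def B_def algebra_simps power2_eq_square)
    finally show ?thesis using lb by simp
  qed
  have "P (t\<^sup>2) \<le> P (s\<^sup>2)"
  proof (rule DERIV_nonpos_imp_nonincreasing[where f = P and a = "s\<^sup>2" and b = "t\<^sup>2"])
    show "s\<^sup>2 \<le> t\<^sup>2" using st by (simp add: power_mono)
    fix \<sigma> assume \<sigma>: "s\<^sup>2 \<le> \<sigma>" "\<sigma> \<le> t\<^sup>2"
    then have \<sigma>0: "0 \<le> \<sigma>" using zero_le_power2[of s] by linarith
    have "t\<^sup>2 < 1" using st by (simp add: abs_square_less_1)
    then have "0 \<le> u \<sigma>" "u \<sigma> \<le> 1" using \<sigma> \<sigma>0 by (auto simp: u_def)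
    then show "\<exists>d. DERIV P \<sigma> :> d \<and> d \<le> 0" using dP[OF \<sigma>0] Q by blast
  qed
  then show ?thesis using Pp st by simp
qed

text \<open>
  This is the Taylor series of \<open>p\<close> in closed form.  The coefficients of \<open>z^(2 n)\<close> are an affine
  function of \<open>n\<close> for even \<open>n\<close> and another one for odd \<open>n\<close>; summing each family with
  \<open>1 / (1 - z\<^sup>4)\<close> and \<open>z\<^sup>4 / (1 - z\<^sup>4)\<^sup>2\<close> leaves four constants, whose signs decide whether
  all Taylor coefficients are nonnegative.
\<close>
lemma pfun_power_series_form:
  fixes z :: "'a :: real_field" and a b :: real
  assumes "1 - z^4 \<noteq> 0"
  shows "pfun a b z = of_real (8 * (a + b) * (1 - a + b)) * z^4 / (1 - z^4)\<^sup>2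
     + of_real (2 * (a + b)) / (1 - z^4)
     + z\<^sup>2 * (of_real (8 * (a * (1 - a) - b * (1 + b))) * z^4 / (1 - z^4)\<^sup>2
        + of_real (6 * (a - b) - 4 * (a + b)\<^sup>2) / (1 - z^4))"
proof -
  have f: "1 - z^4 = (1 - z\<^sup>2) * (1 + z\<^sup>2)" by (simp add: algebra_simps power2_eq_square eval_nat_numeral)
  then have nz: "1 - z\<^sup>2 \<noteq> 0" "1 + z\<^sup>2 \<noteq> 0" using assms by auto
  define s where "s = z\<^sup>2"
  define \<alpha> where "\<alpha> = (of_real a :: 'a)"
  define \<beta> where "\<beta> = (of_real b :: 'a)"
  have z4: "z^4 = s\<^sup>2" by (simp add: s_def power_mult[symmetric])
  let ?A = "(2*\<alpha> - 4*\<alpha>*\<beta>) + s * (2*\<alpha> + 4*\<alpha>*\<beta> - 4*\<alpha>\<^sup>2)"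
  let ?C = "(2*\<beta> + 4*\<alpha>*\<beta>) + s * (- 2*\<beta> - 4*\<beta>\<^sup>2 + 4*\<alpha>*\<beta>)"
  have "pfun a b z = ?A / (1 - s)\<^sup>2 + ?C / (1 + s)\<^sup>2"
    by (simp add: pfun_def s_def \<alpha>_def \<beta>_def)
  also have "\<dots> = (?A * (1 + s)\<^sup>2 + ?C * (1 - s)\<^sup>2) / (1 - z^4)\<^sup>2"
    using nz unfolding f s_def power_mult_distrib by (simp add: add_divide_distrib)
  also have "?A * (1 + s)\<^sup>2 + ?C * (1 - s)\<^sup>2
     = 8 * (\<alpha> + \<beta>) * (1 - \<alpha> + \<beta>) * z^4 + 2 * (\<alpha> + \<beta>) * (1 - z^4)
       + s * (8 * (\<alpha> * (1 - \<alpha>) - \<beta> * (1 + \<beta>)) * z^4 + (6 * (\<alpha> - \<beta>) - 4 * (\<alpha> + \<beta>)\<^sup>2) * (1 - z^4))"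
    unfolding z4 by algebra
  also have "\<dots> / (1 - z^4)\<^sup>2 = 8 * (\<alpha> + \<beta>) * (1 - \<alpha> + \<beta>) * z^4 / (1 - z^4)\<^sup>2 + 2 * (\<alpha> + \<beta>) / (1 - z^4)
       + s * (8 * (\<alpha> * (1 - \<alpha>) - \<beta> * (1 + \<beta>)) * z^4 / (1 - z^4)\<^sup>2 + (6 * (\<alpha> - \<beta>) - 4 * (\<alpha> + \<beta>)\<^sup>2) / (1 - z^4))"
    using assms by (simp add: add_divide_distrib distrib_left power2_eq_square[of "1 - z^4"])
  finally show ?thesis by (simp add: s_def \<alpha>_def \<beta>_def)
qed

text \<open>
  Nonnegative Taylor coefficients make \<open>p\<close> its own majorant.  On the closed form this is the triangle inequality
  together with \<open>\<bar>1 - z\<^sup>4\<bar> \<ge> 1 - \<bar>z\<bar>\<^sup>4\<close>.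
\<close>
lemma norm_pfun_le:
  fixes a b :: real and z :: complex
  assumes coeff: "0 \<le> (a + b) * (1 - a + b)" "0 \<le> a + b"
      "0 \<le> a * (1 - a) - b * (1 + b)" "0 \<le> 6 * (a - b) - 4 * (a + b)\<^sup>2"
    and z: "cmod z < 1"
  shows "cmod (pfun a b z) \<le> pfun a b (cmod z)"
proof -
  define r where "r = cmod z"
  have r: "0 \<le> r" "r < 1" using z by (auto simp: r_def)
  then have r4: "r^4 < 1" by (simp add: power_less_one_iff)
  have nz: "1 - r^4 \<le> cmod (1 - z^4)"
    using norm_triangle_ineq2[of 1 "z^4"] by (simp add: norm_power r_def)
  then have z4: "1 - z^4 \<noteq> 0" using r4 by auto
  have i1: "cmod (of_real c / (1 - z^4)) \<le> c / (1 - r^4)" if "c \<ge> 0" for c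
    using that nz r4 by (simp add: norm_divide frac_le)
  have i2: "cmod (of_real c * z^4 / (1 - z^4)\<^sup>2) \<le> c * r^4 / (1 - r^4)\<^sup>2" if "c \<ge> 0" for c
    using that nz r4 r
    by (simp add: norm_divide norm_mult norm_power r_def[symmetric]) (intro frac_le power_mono; simp)
  define c1 where "c1 = 8 * (a + b) * (1 - a + b)"
  define c2 where "c2 = 2 * (a + b)"
  define c3 where "c3 = 8 * (a * (1 - a) - b * (1 + b))"
  define c4 where "c4 = 6 * (a - b) - 4 * (a + b)\<^sup>2"
  have c: "c1 \<ge> 0" "c2 \<ge> 0" "c3 \<ge> 0" "c4 \<ge> 0"
    using coeff unfolding c1_def c2_def c3_def c4_def mult.assoc by auto
  have "pfun a b z = of_real c1 * z^4 / (1 - z^4)\<^sup>2 + of_real c2 / (1 - z^4)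
     + z\<^sup>2 * (of_real c3 * z^4 / (1 - z^4)\<^sup>2 + of_real c4 / (1 - z^4))"
    unfolding c1_def c2_def c3_def c4_def by (rule pfun_power_series_form[OF z4])
  also have "cmod \<dots> \<le> c1 * r^4 / (1 - r^4)\<^sup>2 + c2 / (1 - r^4)
     + r\<^sup>2 * (c3 * r^4 / (1 - r^4)\<^sup>2 + c4 / (1 - r^4))"
    unfolding norm_mult[of "z\<^sup>2"] norm_power r_def[symmetric]
    by (intro norm_triangle_le add_mono i1 i2 c)
       (auto simp: norm_mult norm_power r_def[symmetric] intro!: mult_left_mono norm_triangle_le add_mono i1 i2 c)
  also have "\<dots> = pfun a b r"
    using pfun_power_series_form[of r a b] r4
    by (simp only: of_real_eq_id id_apply c1_def c2_def c3_def c4_def)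
  finally show ?thesis by (simp add: r_def)
qed

text \<open>
  The bound \<open>b \<ge> a - 1\<close> gives the first sign, and the bound with the square root is the third one solved for
  \<open>b\<close>: the point \<open>(a, b)\<close> lies in the disc with centre \<open>(1/2, - 1/2)\<close> and radius \<open>sqrt (1/2)\<close>.  The last
  sign follows from this and \<open>a - b \<ge> 1/2\<close>.
\<close>
lemma pfun_coefficients_nonneg:
  fixes a b :: real
  assumes a: "1/2 \<le> a" "a \<le> 1" and b: "- 1/2 \<le> b" "a - 1 \<le> b" "b \<le> a - 1/2"
    and c: "b \<le> - 1/2 + 1/2 * sqrt (1 + 4*a*(1 - a))"
  shows "0 \<le> (a + b) * (1 - a + b)" "0 \<le> a + b"
    "0 \<le> a * (1 - a) - b * (1 + b)" "0 \<le> 6 * (a - b) - 4 * (a + b)\<^sup>2"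
proof -
  show "0 \<le> a + b" using a b by simp
  then show "0 \<le> (a + b) * (1 - a + b)" using b by (intro mult_nonneg_nonneg) auto
  have "(2 * b + 1)\<^sup>2 \<le> (sqrt (1 + 4*a*(1 - a)))\<^sup>2"
    using b c by (intro power_mono) auto
  moreover have "0 \<le> 1 + 4*a*(1 - a)" using a by simp
  ultimately have "(2 * b + 1)\<^sup>2 \<le> 1 + 4*a*(1 - a)" by simp
  then show circ: "0 \<le> a * (1 - a) - b * (1 + b)"
    by (simp add: power2_eq_square algebra_simps)
  have "(a - b) * (2 * (a - b) - 1) \<ge> 0" using b by (intro mult_nonneg_nonneg) auto
  moreover have "6 * (a - b) - 4 * (a + b)\<^sup>2
      = 8 * (a * (1 - a) - b * (1 + b)) + 2 * ((a - b) * (2 * (a - b) - 1))"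
    by (simp add: power2_eq_square algebra_simps)
  ultimately show "0 \<le> 6 * (a - b) - 4 * (a + b)\<^sup>2" using circ by simp
qed

section \<open>The extremal function\<close>

text \<open>
  These inequalities keep \<open>1 - z\<^sup>2\<close> and \<open>1 + z\<^sup>2\<close> away from the branch cut of the principal powers.
\<close>
lemma Re_one_pm_square_pos:
  assumes "z \<in> unit_disc"
  shows "Re (1 - z\<^sup>2) > 0" "Re (1 + z\<^sup>2) > 0"
proof -
  have "cmod (z\<^sup>2) < 1" using assms by (simp add: norm_power abs_square_less_1)
  then have "\<bar>Re (z\<^sup>2)\<bar> < 1" using abs_Re_le_cmod[of "z\<^sup>2"] by linarith
  then show "Re (1 - z\<^sup>2) > 0" "Re (1 + z\<^sup>2) > 0" by auto
qed

lemma one_pm_square_nonzero: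
  assumes "z \<in> unit_disc"
  shows "1 - z\<^sup>2 \<noteq> 0" "1 + z\<^sup>2 \<noteq> 0"
proof -
  note p = Re_one_pm_square_pos[OF assms]
  show "1 - z\<^sup>2 \<noteq> 0"
  proof
    assume "1 - z\<^sup>2 = 0"
    with p(1) show False by (simp only: zero_complex.sel)
  qed
  show "1 + z\<^sup>2 \<noteq> 0"
  proof
    assume "1 + z\<^sup>2 = 0"
    with p(2) show False by (simp only: zero_complex.sel)
  qed
qed

definition extremal_deriv :: "real \<Rightarrow> real \<Rightarrow> complex \<Rightarrow> complex" where
  "extremal_deriv a b t = (1 - t\<^sup>2) powr of_real (- 2*a) * (1 + t\<^sup>2) powr of_real (2*b)"

definition extremal_log_deriv :: "real \<Rightarrow> real \<Rightarrow> complex \<Rightarrow> complex" where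
  "extremal_log_deriv a b z = 4 * a * z / (1 - z\<^sup>2) + 4 * b * z / (1 + z\<^sup>2)"

lemma has_field_derivative_powr_log:
  fixes h :: "complex \<Rightarrow> complex"
  assumes "(h has_field_derivative h') (at z)" "h z \<notin> \<real>\<^sub>\<le>\<^sub>0"
  shows "((\<lambda>z. h z powr c) has_field_derivative c * h' / h z * h z powr c) (at z)"
proof -
  have "((\<lambda>z. h z powr c) has_field_derivative c * h z powr (c - 1) * h') (at z)"
    using has_field_derivative_powr[OF assms(2), of c] assms(1) by (rule DERIV_chain2)
  moreover have "h z \<noteq> 0" using assms(2) by auto
  ultimately show ?thesis by (simp add: powr_diff ac_simps)
qed

lemma extremal_deriv_nonzero:
  assumes "z \<in> unit_disc"
  shows "extremal_deriv a b z \<noteq> 0"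
  using one_pm_square_nonzero[OF assms] by (simp add: extremal_deriv_def)

lemma extremal_deriv_has_derivative:
  assumes "z \<in> unit_disc"
  shows "(extremal_deriv a b has_field_derivative extremal_deriv a b z * extremal_log_deriv a b z) (at z)"
proof -
  note p = Re_one_pm_square_pos[OF assms]
  have n: "1 - z\<^sup>2 \<notin> \<real>\<^sub>\<le>\<^sub>0" "1 + z\<^sup>2 \<notin> \<real>\<^sub>\<le>\<^sub>0"
    using p by (auto simp: complex_nonpos_Reals_iff)
  have d: "((\<lambda>z. 1 - z\<^sup>2) has_field_derivative - (2 * z)) (at z)"
          "((\<lambda>z. 1 + z\<^sup>2) has_field_derivative 2 * z) (at z)"
    by (auto intro!: derivative_eq_intros)
  have "(extremal_deriv a b has_field_derivative
      (of_real (- 2*a) * - (2 * z) / (1 - z\<^sup>2) * (1 - z\<^sup>2) powr of_real (- 2*a)) * (1 + z\<^sup>2) powr of_real (2*b)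
      + (of_real (2*b) * (2 * z) / (1 + z\<^sup>2) * (1 + z\<^sup>2) powr of_real (2*b)) * (1 - z\<^sup>2) powr of_real (- 2*a)) (at z)"
    unfolding extremal_deriv_def
    by (rule DERIV_mult has_field_derivative_powr_log d n)+
  then show ?thesis
    by (simp add: extremal_deriv_def extremal_log_deriv_def algebra_simps)
qed

lemma extremal_has_derivative:
  assumes "z \<in> unit_disc"
  shows "(extremal a b has_field_derivative extremal_deriv a b z) (at z)"
proof -
  have hol: "extremal_deriv a b holomorphic_on unit_disc"
  proof (rule holomorphic_onI)
    fix w :: complex assume "w \<in> unit_disc"
    from has_field_derivative_at_within[OF extremal_deriv_has_derivative[OF this]]
    show "extremal_deriv a b field_differentiable (at w within unit_disc)"
      unfolding field_differentiable_def by (rule exI)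
  qed
  obtain F where F: "\<And>x. x \<in> unit_disc \<Longrightarrow> (F has_field_derivative extremal_deriv a b x) (at x within unit_disc)"
    using holomorphic_convex_primitive'[OF convex_ball open_ball hol] by blast
  have E: "extremal a b w = F w - F 0" if w: "w \<in> unit_disc" for w
  proof -
    have "closed_segment 0 w \<subseteq> unit_disc"
      using w by (intro closed_segment_subset) auto
    then have "(extremal_deriv a b has_contour_integral F w - F 0) (linepath 0 w)"
      using contour_integral_primitive[OF F valid_path_linepath] by simp
    then show ?thesis
      unfolding extremal_def extremal_deriv_def by (rule contour_integral_unique)
  qed
  have "(F has_field_derivative extremal_deriv a b z) (at z)"
    using F[OF assms] at_within_open[OF assms open_ball] by simp
  then have "((\<lambda>w. F w - F 0) has_field_derivative extremal_deriv a b z) (at z)"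
    by (auto intro!: derivative_eq_intros)
  then show ?thesis
    by (rule has_field_derivative_transform_within_open[OF _ open_ball assms]) (simp add: E)
qed

lemma extremal_analytic: "extremal a b analytic_on unit_disc"
proof -
  have "extremal a b holomorphic_on unit_disc"
  proof (rule holomorphic_onI)
    fix w :: complex assume "w \<in> unit_disc"
    from has_field_derivative_at_within[OF extremal_has_derivative[OF this]]
    show "extremal a b field_differentiable (at w within unit_disc)"
      unfolding field_differentiable_def by (rule exI)
  qed
  then show ?thesis by (simp add: analytic_on_open)
qed

lemma extremal_locally_univalent: "locally_univalent_on (extremal a b) unit_disc"
  unfolding locally_univalent_on_def univalent_on_def
proof
  fix z :: complex assume z: "z \<in> unit_disc"
  have h: "extremal a b holomorphic_on unit_disc"
    using extremal_analytic by (rule analytic_imp_holomorphic)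
  have "deriv (extremal a b) z \<noteq> 0"
    using DERIV_imp_deriv[OF extremal_has_derivative[OF z]] extremal_deriv_nonzero[OF z] by simp
  then obtain r where "r > 0" "ball z r \<subseteq> unit_disc" "inj_on (extremal a b) (ball z r)"
    by (rule has_complex_derivative_locally_injective[OF h z open_ball])
  then show "\<exists>U. open U \<and> z \<in> U \<and> U \<subseteq> unit_disc \<and> inj_on (extremal a b) U"
    by (intro exI[of _ "ball z r"]) auto
qed

text \<open>
  The derivative of the extremal function is even, so \<open>extremal z + extremal (- z)\<close> is constant, and it vanishes at \<open>0\<close>.
\<close>
lemma extremal_odd:
  assumes "z \<in> unit_disc"
  shows "extremal a b (- z) = - extremal a b z"
proof -
  have "((\<lambda>w. extremal a b w + extremal a b (- w)) has_field_derivative 0) (at w within unit_disc)"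
    if w: "w \<in> unit_disc" for w
  proof -
    have "((\<lambda>w. extremal a b (- w)) has_field_derivative extremal_deriv a b (- w) * - 1) (at w)"
      by (rule DERIV_chain2[where g = uminus, OF extremal_has_derivative])
        (use w in \<open>auto intro!: derivative_eq_intros\<close>)
    then have "((\<lambda>w. extremal a b w + extremal a b (- w)) has_field_derivative
        extremal_deriv a b w + extremal_deriv a b (- w) * - 1) (at w)"
      by (rule DERIV_add[OF extremal_has_derivative[OF w]])
    moreover have "extremal_deriv a b w + extremal_deriv a b (- w) * - 1 = 0"
      by (simp add: extremal_deriv_def)
    ultimately show ?thesis
      by (metis has_field_derivative_at_within)
  qed
  then have "\<exists>c. \<forall>w\<in>unit_disc. extremal a b w + extremal a b (- w) = c"
    by (rule has_field_derivative_zero_constant[OF convex_ball])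
  then obtain c where c: "\<And>w. w \<in> unit_disc \<Longrightarrow> extremal a b w + extremal a b (- w) = c"
    by blast
  have "extremal a b 0 = 0"
    by (simp add: extremal_def)
  then have "c = 0" using c[of 0] by simp
  then show ?thesis using c[OF assms] by (simp add: eq_neg_iff_add_eq_0 add.commute)
qed

text \<open>
  The derivative of the extremal function is \<open>y\<^sup>-\<^sup>2\<close>, so its logarithmic derivative is \<open>- 2 L\<close> with \<open>L = y' / y\<close>, and
  \<open>- 2 L' - (- 2 L)\<^sup>2 / 2 = - 2 (L' + L\<^sup>2) = 2 p\<close>.
\<close>
lemma Schwarzian_extremal:
  assumes z: "z \<in> unit_disc"
  shows "Schwarzian (extremal a b) z = 2 * pfun a b z"
proof -
  let ?f = "extremal a b"
  have nhds: "eventually (\<lambda>w. w \<in> unit_disc) (nhds w)" if "w \<in> unit_disc" for w :: complex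
    using that by (intro eventually_nhds_in_open) auto
  have f1: "deriv ?f w = extremal_deriv a b w" if "w \<in> unit_disc" for w
    using extremal_has_derivative[OF that] by (rule DERIV_imp_deriv)
  have f2: "deriv (deriv ?f) w = extremal_deriv a b w * extremal_log_deriv a b w" if "w \<in> unit_disc" for w
  proof -
    have "deriv (deriv ?f) w = deriv (extremal_deriv a b) w"
    proof (rule deriv_cong_ev)
      show "eventually (\<lambda>v. deriv ?f v = extremal_deriv a b v) (nhds w)"
        using nhds[OF that] by (rule eventually_mono) (rule f1)
    qed simp
    then show ?thesis
      using DERIV_imp_deriv[OF extremal_deriv_has_derivative[OF that]] by simp
  qed
  have q: "deriv (deriv ?f) w / deriv ?f w = extremal_log_deriv a b w" if "w \<in> unit_disc" for w
    using that extremal_deriv_nonzero[OF that] by (simp add: f1 f2)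
  note nz = one_pm_square_nonzero[OF z]
  have 1: "((\<lambda>x. 4 * complex_of_real a * x / (1 - x\<^sup>2)) has_field_derivative 4 * a * (1 + z\<^sup>2) / (1 - z\<^sup>2)\<^sup>2) (at z)"
    using nz(1) by (auto intro!: derivative_eq_intros simp: power2_eq_square algebra_simps)
  have 2: "((\<lambda>x. 4 * complex_of_real b * x / (1 + x\<^sup>2)) has_field_derivative 4 * b * (1 - z\<^sup>2) / (1 + z\<^sup>2)\<^sup>2) (at z)"
    using nz(2) by (auto intro!: derivative_eq_intros simp: power2_eq_square algebra_simps)
  have "deriv (\<lambda>w. deriv (deriv ?f) w / deriv ?f w) z = deriv (extremal_log_deriv a b) z"
  proof (rule deriv_cong_ev)
    show "eventually (\<lambda>v. deriv (deriv ?f) v / deriv ?f v = extremal_log_deriv a b v) (nhds z)"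
      using nhds[OF z] by (rule eventually_mono) (rule q)
  qed simp
  also have "\<dots> = 4 * a * (1 + z\<^sup>2) / (1 - z\<^sup>2)\<^sup>2 + 4 * b * (1 - z\<^sup>2) / (1 + z\<^sup>2)\<^sup>2"
    unfolding extremal_log_deriv_def by (rule DERIV_imp_deriv DERIV_add 1 2)+
  finally have "Schwarzian ?f z = 4 * a * (1 + z\<^sup>2) / (1 - z\<^sup>2)\<^sup>2 + 4 * b * (1 - z\<^sup>2) / (1 + z\<^sup>2)\<^sup>2
      - 1/2 * (extremal_log_deriv a b z)\<^sup>2"
    unfolding Schwarzian_def q[OF z] by simp
  also have "extremal_log_deriv a b z = 2 * (2 * a * z / (1 - z\<^sup>2) + 2 * b * z / (1 + z\<^sup>2))"
    by (simp add: extremal_log_deriv_def mult.assoc)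
  finally show ?thesis
    unfolding pfun_log_derivative[OF nz, symmetric] power_mult_distrib
    by (simp add: algebra_simps)
qed

section \<open>Criterion, majorance and sharpness\<close>

lemma pfun_analytic: "pfun a b analytic_on unit_disc"
proof -
  have "pfun a b holomorphic_on unit_disc"
    unfolding pfun_def using one_pm_square_nonzero by (intro holomorphic_intros) auto
  then show ?thesis by (simp add: analytic_on_open)
qed

lemma univalence_criterion:
  fixes a b :: real
  assumes ab: "1/2 \<le> a" "a \<le> 1"
      "1/4 * (- (5 + 4*a) + sqrt (25 + 48*a)) \<le> b" "b \<le> a - 1/2"
    and f: "f analytic_on unit_disc" "locally_univalent_on f unit_disc"
    and S: "\<And>z. z \<in> unit_disc \<Longrightarrow> cmod (Schwarzian f z) \<le> 2 * pfun a b (cmod z)"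
  shows "inj_on f unit_disc"
proof (rule Nehari_univalence[OF ysol_pos ysol_has_derivative ysol_ode _ _ f S])
  show "pfun a b (- x) = pfun a b x" for x :: real by (simp add: pfun_def)
qed (use pfun_weighted_antimono[OF ab] in auto)

text \<open>
  By the identity theorem, agreement of \<open>Sf\<close> and \<open>2 p\<close> on the real axis would extend to the disc.  Hence a
  hypothesis about the whole disc yields a real point of strict inequality, as
  \<open>Schwarzian_not_univalent\<close> requires.
\<close>
lemma Schwarzian_differs_on_axis:
  assumes f: "f analytic_on unit_disc" "locally_univalent_on f unit_disc"
    and ne: "\<not> (\<forall>z\<in>unit_disc. Schwarzian f z = 2 * pfun a b z)"
  obtains x :: real where "\<bar>x\<bar> < 1" "Schwarzian f (of_real x) \<noteq> 2 * pfun a b (of_real x)"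
proof (rule ccontr)
  assume no_point: "\<not> thesis"
  note point_found = that
  let ?U = "complex_of_real ` {-1<..<1}"
  have "Schwarzian f z - 2 * pfun a b z = 0" if "z \<in> unit_disc" for z
  proof (rule analytic_continuation[of "\<lambda>z. Schwarzian f z - 2 * pfun a b z" unit_disc ?U 0])
    show "(\<lambda>z. Schwarzian f z - 2 * pfun a b z) holomorphic_on unit_disc"
      by (intro holomorphic_intros Schwarzian_holomorphic f analytic_imp_holomorphic[OF pfun_analytic])
    show "0 islimpt ?U"
      unfolding islimpt_approachable
    proof (intro allI impI)
      fix e :: real assume "e > 0"
      then show "\<exists>w\<in>?U. w \<noteq> 0 \<and> dist w 0 < e"
        by (intro bexI[of _ "of_real (min (e / 2) (1 / 2))"]) (auto simp: min_def)
    qed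
    show "Schwarzian f w - 2 * pfun a b w = 0" if w: "w \<in> ?U" for w
    proof -
      obtain x where x: "\<bar>x\<bar> < 1" "w = of_real x"
        using w by (auto simp: abs_less_iff)
      then show ?thesis using point_found[OF x(1)] no_point by auto
    qed
  qed (use that in auto)
  then show False using ne by simp
qed

lemma pfun_sharp:
  fixes a b :: real
  assumes ab: "1/2 \<le> a" "- 1/2 \<le> b"
  shows "sharp_criterion (pfun a b)"
  unfolding sharp_criterion_def univalent_on_def
proof (intro allI impI)
  fix f assume f: "f analytic_on unit_disc" "locally_univalent_on f unit_disc"
    and S: "\<forall>x::real. - 1 < x \<and> x < 1 \<longrightarrow> Schwarzian f (of_real x) \<in> \<real> \<and>
        2 * Re (pfun a b (complex_of_real x)) \<le> Re (Schwarzian f (of_real x))"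
    and ne: "\<not> (\<forall>z\<in>unit_disc. Schwarzian f z = 2 * pfun a b z)"
  have Sreal: "Schwarzian f (of_real x) \<in> \<real>" if "\<bar>x\<bar> < 1" for x
    using S that by (auto simp: abs_less_iff)
  have Sge: "2 * pfun a b x \<le> Re (Schwarzian f (of_real x))" if "\<bar>x\<bar> < 1" for x
    using S[rule_format, of x] that by (auto simp: abs_less_iff pfun_of_real)
  obtain x0 :: real where x0: "\<bar>x0\<bar> < 1" "Schwarzian f (of_real x0) \<noteq> 2 * pfun a b (of_real x0)"
    using Schwarzian_differs_on_axis[OF f ne] by blast
  have "Re (Schwarzian f (of_real x0)) \<noteq> 2 * pfun a b x0"
    using x0(2) Sreal[OF x0(1)] by (auto simp: pfun_of_real complex_is_Real_iff complex_eq_iff)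
  then have gt: "2 * pfun a b x0 < Re (Schwarzian f (of_real x0))"
    using Sge[OF x0(1)] by simp
  have "(ysol a b x)\<^sup>2 \<le> 4 * (1 - \<bar>x\<bar>)" if "\<bar>x\<bar> < 1" for x
    using ysol_square_le[OF ab, of x] ysol_square_le[OF ab, of "- x"] that
    by (cases "x \<ge> 0") (auto simp: ysol_def)
  then show "\<not> inj_on f unit_disc"
    using Schwarzian_not_univalent[OF ysol_pos ysol_has_derivative ysol_ode _ _ f Sreal Sge x0(1) gt, of 4]
    by simp
qed

theorem theorem3:
  fixes a b :: real
  shows
    "(1/2 \<le> a \<and> a \<le> 1 \<and>
      1/4 * (- (5 + 4*a) + sqrt (25 + 48*a)) \<le> b \<and> b \<le> a - 1/2
      \<longrightarrow>
      (\<forall>f :: complex \<Rightarrow> complex.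
         f analytic_on unit_disc \<longrightarrow> locally_univalent_on f unit_disc \<longrightarrow>
         (\<forall>z\<in>unit_disc. cmod (Schwarzian f z) \<le> 2 * pfun a b (cmod z)) \<longrightarrow>
         univalent_on f unit_disc))
     \<and>
     (1/2 \<le> a \<and> a \<le> 1 \<and>
      max (a - 1) (1/4 * (- (5 + 4*a) + sqrt (25 + 48*a))) \<le> b \<and>
      b \<le> min (a - 1/2) (- 1/2 + 1/2 * sqrt (1 + 4*a*(1 - a)))
      \<longrightarrow>
      self_majorant (pfun a b) \<and>
      extremal a b analytic_on unit_disc \<and>
      (\<forall>z\<in>unit_disc. extremal a b (- z) = - extremal a b z) \<and>
      univalent_on (extremal a b) unit_disc \<and>
      sharp_criterion (pfun a b))"
proof (intro conjI impI)
  assume "1/2 \<le> a \<and> a \<le> 1 \<and>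
      1/4 * (- (5 + 4*a) + sqrt (25 + 48*a)) \<le> b \<and> b \<le> a - 1/2"
  then show "\<forall>f. f analytic_on unit_disc \<longrightarrow> locally_univalent_on f unit_disc \<longrightarrow>
         (\<forall>z\<in>unit_disc. cmod (Schwarzian f z) \<le> 2 * pfun a b (cmod z)) \<longrightarrow>
         univalent_on f unit_disc"
    unfolding univalent_on_def using univalence_criterion by blast
next
  assume "1/2 \<le> a \<and> a \<le> 1 \<and>
      max (a - 1) (1/4 * (- (5 + 4*a) + sqrt (25 + 48*a))) \<le> b \<and>
      b \<le> min (a - 1/2) (- 1/2 + 1/2 * sqrt (1 + 4*a*(1 - a)))"
  then have a: "1/2 \<le> a" "a \<le> 1"
    and b: "a - 1 \<le> b" "1/4 * (- (5 + 4*a) + sqrt (25 + 48*a)) \<le> b" "b \<le> a - 1/2"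
      "b \<le> - 1/2 + 1/2 * sqrt (1 + 4*a*(1 - a))"
    by simp_all
  have b_lower: "- 1/2 \<le> b"
    by (rule admissible_lower_bound(1)[OF a b(2)])
  have majorant: "cmod (pfun a b z) \<le> pfun a b (cmod z)" if "z \<in> unit_disc" for z
    using norm_pfun_le[OF pfun_coefficients_nonneg[OF a b_lower b(1,3,4)]] that by simp
  then show "self_majorant (pfun a b)"
    by (simp add: self_majorant_def pfun_analytic pfun_of_real)
  show "extremal a b analytic_on unit_disc"
    by (rule extremal_analytic)
  show "\<forall>z\<in>unit_disc. extremal a b (- z) = - extremal a b z"
    using extremal_odd by blast
  show "univalent_on (extremal a b) unit_disc"
    unfolding univalent_on_def
    by (rule univalence_criterion[OF a b(2,3) extremal_analytic extremal_locally_univalent])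
      (use majorant in \<open>simp add: Schwarzian_extremal norm_mult\<close>)
  show "sharp_criterion (pfun a b)"
    using a(1) b_lower by (rule pfun_sharp)
qed

end
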